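(* Assume (A1) and (C1). Then $$\sup_{x\in[0,1]^d}|g_n(x)-Eg_n(x)|=O_{a.s.}\!\left[\frac{(\log n)^{1/2}}{(nh_n)^{d/2}}\right].$$
   Context: Fix an integer $d\ge1$. For $x=(x_1,\dots,x_d)\in\mathbb{R}^d$ let $\|x\|=\max_{1\le k\le d}|x_k|$; for $i,j\in\mathbb{Z}^d$ let $|i-j|=\max_{1\le l\le d}|i_l-j_l|$, and $|k|=|k-0|$. Let $(\varepsilon_i)_{i\in\mathbb{Z}^d}$ be a strictly stationary real random field on a probability space $(\Omega,\mathcal F,\mathbb P)$ with $E\varepsilon_0=0$. Strict stationarity means: for all $k\in\mathbb{Z}^d$, $n\ge1$ and $i_1,\dots,i_n\in\mathbb{Z}^d$, the vectors $(\varepsilon_{i_1},\dots,\varepsilon_{i_n})$ and $(\varepsilon_{i_1+k},\dots,\varepsilon_{i_n+k})$ have the same law. Let $g:[0,1]^d\to\mathbb{R}$ and $\Lambda_n=\{1,\dots,n\}^d$, and set $Y_i=g(i/n)+\varepsilon_i$ for $i\in\Lambda_n$. Let $K$ be a probability density on $\mathbb{R}^d$ and $(h_n)_{n\ge1}$ positive numbers with $h_n\to0$ and $nh_n\to\infty$. For $x\in[0,1]^d$ define $$g_n(x)=\frac{\sum_{i\in\Lambda_n}Y_i\,K\big((x-i/n)/h_n\big)}{\sum_{i\in\Lambda_n}K\big((x-i/n)/h_n\big)}.$$ Assumption (A1): $K$ is symmetric and nonnegative, and supported in $[-1,1]^d$. There is $\eta>0$ with $|K(x)-K(y)|\le\eta\|x-y\|$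 for all $x,y\in[-1,1]^d$, and there are constants $c,C>0$ with $c\le K(x)\le C$ for all $x\in[-1,1]^d$. Notation $O_{a.s.}$: for real random variables $Z_n$ and positive numbers $v_n$, $Z_n=O_{a.s.}[v_n]$ means there exists a deterministic $\lambda>0$ with $\limsup_{n\to\infty}|Z_n|/v_n\le\lambda$ almost surely. Dependence notation: $i<_{lex}j$ for distinct $i,j\in\mathbb{Z}^d$ means either $i_1<j_1$, or for some $p\in\{2,\dots,d\}$ one has $i_p<j_p$ and $i_q=j_q$ for $1\le q<p$. Set $V_i^1=\{j\in\mathbb{Z}^d: j<_{lex}i\}$ and, for integers $m\ge2$, $V_i^m=V_i^1\cap\{j:|i-j|\ge m\}$. For $\Gamma\subset\mathbb{Z}^d$ let $\mathcal F_\Gamma=\sigma(\varepsilon_j: j\in\Gamma)$. For $k\in V_0^1$ (so $|k|\ge1$) put $E_{|k|}(\varepsilon_0)=E(\varepsilon_0\mid\mathcal F_{V_0^{|k|}})$. Condition (C1): $\varepsilon_0\in L^\infty$ and $\sum_{k\in V_0^1}\|\varepsilon_kE_{|k|}(\varepsilon_0)\|_\infty<\infty$. *)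

theory Defs
  imports "HOL-Probability.Probability"
begin

definition inorm :: "int^'d::finite \<Rightarrow> int" where
  "inorm i = Max (range (\<lambda>l. \<bar>i $ l\<bar>))"

definition rnorm :: "real^'d::finite \<Rightarrow> real" where
  "rnorm x = Max (range (\<lambda>l. \<bar>x $ l\<bar>))"

definition lexless :: "(int, 'd::{finite,linorder}) vec \<Rightarrow> (int, 'd) vec \<Rightarrow> bool" where
  "lexless i j \<longleftrightarrow> (\<exists>p. i $ p < j $ p \<and> (\<forall>q. q < p \<longrightarrow> i $ q = j $ q))"

text \<open>V_0^m (for m = 1 this is just V_0^1, since |j| >= 1 for j <lex 0).\<close>
definition Vset :: "int \<Rightarrow> (int^'d::{finite,linorder}) set" where
  "Vset m = {j. lexless j 0 \<and> inorm j \<ge> m}"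

definition field_sigma :: "'a measure \<Rightarrow> ('i \<Rightarrow> 'a \<Rightarrow> real) \<Rightarrow> 'i set \<Rightarrow> 'a measure" where
  "field_sigma M eps \<Gamma> =
     sigma (space M) {eps j -` A \<inter> space M | j A. j \<in> \<Gamma> \<and> A \<in> sets borel}"

definition strictly_stationary :: "'a measure \<Rightarrow> (int^'d::finite \<Rightarrow> 'a \<Rightarrow> real) \<Rightarrow> bool" where
  "strictly_stationary M eps \<longleftrightarrow>
     (\<forall>k J. finite J \<longrightarrow>
        distr M (PiM J (\<lambda>_. borel)) (\<lambda>\<omega>. restrict (\<lambda>j. eps j \<omega>) J) =
        distr M (PiM J (\<lambda>_. borel)) (\<lambda>\<omega>. restrict (\<lambda>j. eps (j + k) \<omega>) J))"

definition linf :: "'a measure \<Rightarrow> ('a \<Rightarrow> real) \<Rightarrow> ereal" where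
  "linf M f = esssup M (\<lambda>\<omega>. ereal \<bar>f \<omega>\<bar>)"

definition vec_of_int :: "int^'d::finite \<Rightarrow> real^'d" where
  "vec_of_int i = (\<chi> l. real_of_int (i $ l))"

definition Lambda :: "nat \<Rightarrow> (int^'d::finite) set" where
  "Lambda n = {i. \<forall>l. 1 \<le> i $ l \<and> i $ l \<le> int n}"

definition unit_cube :: "(real^'d::finite) set" where
  "unit_cube = {x. \<forall>l. 0 \<le> x $ l \<and> x $ l \<le> 1}"

definition gn :: "(real^'d::finite \<Rightarrow> real) \<Rightarrow> (int^'d \<Rightarrow> 'a \<Rightarrow> real) \<Rightarrow> (real^'d \<Rightarrow> real)
                  \<Rightarrow> (nat \<Rightarrow> real) \<Rightarrow> nat \<Rightarrow> real^'d \<Rightarrow> 'a \<Rightarrow> real" where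
  "gn g eps K h n x \<omega> =
    (\<Sum>i\<in>Lambda n. (g ((1 / real n) *\<^sub>R vec_of_int i) + eps i \<omega>)
                     * K ((1 / h n) *\<^sub>R (x - (1 / real n) *\<^sub>R vec_of_int i)))
    / (\<Sum>i\<in>Lambda n. K ((1 / h n) *\<^sub>R (x - (1 / real n) *\<^sub>R vec_of_int i)))"

end

theory Submission
  imports Defs
begin

text \<open>The centred estimator is a weighted mean of the noise over the window of design points seen from
  \<open>x\<close>. For coefficients bounded by \<open>\<theta>\<close>, the moment \<open>E cosh (\<Sum>i\<in>W. a\<^sub>i \<epsilon>\<^sub>i)\<close> is at most
  \<open>exp (\<theta>\<^sup>2 L |W|)\<close>: after translating the lexicographically last site to the origin,
  \<open>cosh (u + x) \<le> cosh u exp (x\<^sup>2) + x sinh u\<close> leaves the covariance of \<open>\<epsilon>\<^sub>0\<close> with the \<open>sinh\<close> of the earlier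
  sites. Removing these one by one, the nearest first, each increment of \<open>sinh\<close> is \<open>\<epsilon>\<^sub>k\<close> times a quantity
  measurable with respect to the sites at distance at least \<open>|k|\<close>, so (C1) controls it by
  conditioning. This gives a Gaussian tail for each fixed \<open>x\<close>. Since the unit cube splits into
  polynomially many classes on which the window is constant and the kernel weights are nearly
  constant, a union bound and the Borel-Cantelli lemma finish the proof.\<close>

section \<open>Exponential moments under projective dependence\<close>

text \<open>For \<open>y \<ge> 1\<close> already \<open>y \<le> y\<^sup>2\<close>; otherwise
  \<open>exp y \<le> 1 + y + y\<^sup>2\<close> and
  \<open>1 + y\<^sup>2 \<le> exp (y\<^sup>2)\<close>. The linear term is kept apart because it later
  carries the covariance.\<close>

lemma exp_le_add_exp_square: "exp y \<le> y + exp (y\<^sup>2)" for y :: real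
proof -
  have sq: "1 + y\<^sup>2 \<le> exp (y\<^sup>2)"
    by simp
  consider "y \<ge> 1" | "0 \<le> y" "y \<le> 1" | "y \<le> 0"
    by linarith
  then show ?thesis
  proof cases
    case 1
    then have "y \<le> y\<^sup>2"
      by (simp add: power2_eq_square)
    with 1 show ?thesis
      by (smt (verit) exp_le_cancel_iff)
  next
    case 2
    then show ?thesis
      using exp_bound[of y] sq by linarith
  next
    case 3
    define x where "x = - y"
    have x: "x \<ge> 0"
      using 3 by (simp add: x_def)
    \<comment> \<open>To bound \<open>exp (- x)\<close> by the first factor, that factor times
      \<open>exp x\<close> must be at least 1. The quadratic Taylor polynomial of
      \<open>exp x\<close> is enough, since the product exceeds 1 by nonnegative terms only.\<close>
    have "(1 - x + x\<^sup>2) * (1 + x + x\<^sup>2 / 2) = 1 + (x\<^sup>2 + x ^ 3 + x ^ 4) / 2"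
      by (simp add: field_simps power2_eq_square power3_eq_cube power4_eq_xxxx)
    then have "1 \<le> (1 - x + x\<^sup>2) * (1 + x + x\<^sup>2 / 2)"
      using x by simp
    also have "\<dots> \<le> (1 - x + x\<^sup>2) * exp x"
    proof (rule mult_left_mono)
      show "0 \<le> 1 - x + x\<^sup>2"
        using zero_le_power2[of "x - 1 / 2"] by (simp add: power2_eq_square algebra_simps)
    qed (use x exp_lower_Taylor_quadratic in auto)
    finally have "exp (- x) \<le> 1 - x + x\<^sup>2"
      by (simp add: exp_minus field_simps)
    then have "exp y \<le> 1 + y + y\<^sup>2"
      by (simp add: x_def)
    with sq show ?thesis
      by linarith
  qed
qed

text \<open>Average the previous bound at \<open>x\<close> and \<open>- x\<close> with weights
  \<open>exp u\<close> and \<open>exp (- u)\<close>: the linear parts combine to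
  \<open>x * sinh u\<close>. For independent centred summands this term would have mean zero; here
  it measures the dependence.\<close>

lemma cosh_add_le: "cosh (u + x) \<le> cosh u * exp (x\<^sup>2) + x * sinh u" for u x :: real
proof -
  have "cosh (u + x) = (exp u * exp x + exp (- u) * exp (- x)) / 2"
    by (simp add: cosh_field_def flip: exp_add)
  also have "\<dots> \<le> (exp u * (x + exp (x\<^sup>2)) + exp (- u) * (- x + exp (x\<^sup>2))) / 2"
    using exp_le_add_exp_square[of x] exp_le_add_exp_square[of "- x"]
    by (intro divide_right_mono add_mono mult_left_mono) auto
  also have "\<dots> = cosh u * exp (x\<^sup>2) + x * sinh u"
    by (simp add: cosh_field_def sinh_field_def field_simps)
  finally show ?thesis .
qed

lemma abs_sinh_le_cosh: "\<bar>sinh u\<bar> \<le> cosh u" for u :: real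
  using sinh_le_cosh_real[of "\<bar>u\<bar>"] by simp

text \<open>By the mean value theorem the slope is \<open>cosh z\<close> at an intermediate
  \<open>z\<close>, and \<open>cosh\<close> is even and increasing in the modulus, so one end point
  dominates. The sum of both end values is easy to integrate. For \<open>y = 0\<close> the quotient
  is 0.\<close>

lemma sinh_slope_le: "\<bar>(sinh (t + y) - sinh t) / y\<bar> \<le> cosh t + cosh (t + y)" for t y :: real
proof (cases "y = 0")
  case False
  have mono: "cosh z \<le> cosh t + cosh (t + y)" if "\<bar>z\<bar> \<le> max \<bar>t\<bar> \<bar>t + y\<bar>" for z
  proof -
    have "cosh \<bar>z\<bar> \<le> cosh (max \<bar>t\<bar> \<bar>t + y\<bar>)"
      using that by (subst cosh_real_nonneg_le_iff) auto
    also have "\<dots> \<le> cosh t + cosh (t + y)"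
      by (auto simp: max_def)
    finally show ?thesis by simp
  qed
  have "\<exists>z. \<bar>z\<bar> \<le> max \<bar>t\<bar> \<bar>t + y\<bar> \<and> sinh (t + y) - sinh t = y * cosh z"
  proof (cases "y > 0")
    case True
    have "\<exists>z. z > t \<and> z < t + y \<and> sinh (t + y) - sinh t = (t + y - t) * cosh z"
      by (rule MVT2) (use True in \<open>auto intro!: derivative_eq_intros\<close>)
    then obtain z where "z > t" "z < t + y" "sinh (t + y) - sinh t = (t + y - t) * cosh z"
      by blast
    then show ?thesis
      by (intro exI[of _ z]) auto
  next
    case False
    have "\<exists>z. z > t + y \<and> z < t \<and> sinh t - sinh (t + y) = (t - (t + y)) * cosh z"
      by (rule MVT2) (use False \<open>y \<noteq> 0\<close> in \<open>auto intro!: derivative_eq_intros\<close>)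
    then obtain z where "z > t + y" "z < t" "sinh t - sinh (t + y) = (t - (t + y)) * cosh z"
      by blast
    then show ?thesis
      by (intro exI[of _ z]) auto
  qed
  then show ?thesis
    using mono False by (auto simp: abs_mult)
qed (simp add: add_nonneg_nonneg)

section \<open>The lexicographic order on the lattice\<close>

lemma lexless_trans: "lexless i j \<Longrightarrow> lexless j k \<Longrightarrow> lexless i k"
  unfolding lexless_def
proof (elim exE conjE)
  fix p q
  assume "i $ p < j $ p" "\<forall>r<p. i $ r = j $ r" "j $ q < k $ q" "\<forall>r<q. j $ r = k $ r"
  then show "\<exists>r. i $ r < k $ r \<and> (\<forall>s<r. i $ s = k $ s)"
    by (intro exI[of _ "min p q"]) (cases p q rule: linorder_cases; auto simp: min_def)
qed

lemma lexless_total: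
  assumes "i \<noteq> j"
  shows "lexless i j \<or> lexless j i"
proof -
  define D where "D = {l. i $ l \<noteq> j $ l}"
  have "D \<noteq> {}"
    using assms by (auto simp: D_def vec_eq_iff)
  then have "Min D \<in> D"
    by (intro Min_in) auto
  moreover have "i $ q = j $ q" if "q < Min D" for q
  proof (rule ccontr)
    assume "i $ q \<noteq> j $ q"
    then have "Min D \<le> q"
      by (intro Min_le) (auto simp: D_def)
    with that show False by simp
  qed
  ultimately show ?thesis
    unfolding lexless_def by (metis (mono_tags, lifting) D_def linorder_neqE mem_Collect_eq)
qed

lemma lexless_diff: "lexless (j - i) 0 \<longleftrightarrow> lexless j i"
  by (simp add: lexless_def)

text \<open>Supplies the site to be translated to the origin: afterwards all other sites of
  \<open>W\<close> lie in the lexicographic past \<open>Vset 1\<close>.\<close>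

lemma finite_lexless_maximal:
  assumes "finite W" "W \<noteq> {}"
  shows "\<exists>i\<in>W. \<forall>j\<in>W - {i}. lexless j i"
  using assms
proof (induction rule: finite_ne_induct)
  case (insert x F)
  then obtain i where i: "i \<in> F" "\<forall>j\<in>F - {i}. lexless j i"
    by blast
  with insert.hyps have "i \<noteq> x" by blast
  then consider "lexless i x" | "lexless x i"
    using lexless_total by blast
  then show ?case
  proof cases
    case 1
    with i show ?thesis
      by (intro bexI[of _ x]) (auto intro: lexless_trans)
  next
    case 2
    with i show ?thesis
      by (intro bexI[of _ i]) auto
  qed
qed simp

lemma inorm_pos:
  assumes "lexless j 0"
  shows "inorm j \<ge> 1"
proof -
  obtain p where "j $ p < 0"
    using assms by (auto simp: lexless_def)
  then have "1 \<le> \<bar>j $ p\<bar>" by simp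
  also have "\<dots> \<le> inorm j"
    unfolding inorm_def by (intro Max_ge) auto
  finally show ?thesis .
qed

lemma mem_Vset_1: "j \<in> Vset 1 \<longleftrightarrow> lexless j 0"
  using inorm_pos by (auto simp: Vset_def)

section \<open>The sigma-algebras generated by parts of the field\<close>

lemma space_field_sigma: "space (field_sigma M eps \<Gamma>) = space M"
  unfolding field_sigma_def by (intro space_measure_of) auto

lemma sets_field_sigma:
  "sets (field_sigma M eps \<Gamma>) =
     sigma_sets (space M) {eps j -` A \<inter> space M | j A. j \<in> \<Gamma> \<and> A \<in> sets borel}"
  unfolding field_sigma_def by (intro sets_measure_of) auto

lemma measurable_field_sigma:
  assumes "j \<in> \<Gamma>"
  shows "eps j \<in> borel_measurable (field_sigma M eps \<Gamma>)"
  unfolding measurable_def space_field_sigma sets_field_sigma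
  using assms by (auto intro!: sigma_sets.Basic)

lemma subalgebra_field_sigma:
  assumes "\<And>j. j \<in> \<Gamma> \<Longrightarrow> eps j \<in> borel_measurable M"
  shows "subalgebra M (field_sigma M eps \<Gamma>)"
  unfolding subalgebra_def space_field_sigma sets_field_sigma
  using assms by (auto intro!: sets.sigma_sets_subset measurable_sets)

section \<open>Stationary fields with almost surely bounded marginals\<close>

text \<open>Of (C1) only the bound on \<open>eps 0\<close> enters here, with its constant named; the
  summability part is passed to individual lemmas as \<open>fin\<close> and
  \<open>D\<close>.\<close>

locale stationary_bounded_field = prob_space M for M :: "'a measure" +
  fixes eps :: "(int, 'd::{finite,linorder}) vec \<Rightarrow> 'a \<Rightarrow> real" and B :: real
  assumes eps_measurable [measurable]: "\<And>i. eps i \<in> borel_measurable M"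
    and stationary: "strictly_stationary M eps"
    and eps_0_bounded: "AE \<omega> in M. \<bar>eps 0 \<omega>\<bar> \<le> B"
begin

text \<open>Bundles measurability with an almost sure bound, so that integrability of the noise
  combined by sums, products, \<open>cosh\<close> and \<open>sinh\<close> follows from closure
  rules.\<close>

definition ae_bounded :: "('a \<Rightarrow> real) \<Rightarrow> bool" where
  "ae_bounded f \<longleftrightarrow> f \<in> borel_measurable M \<and> (\<exists>R. AE \<omega> in M. \<bar>f \<omega>\<bar> \<le> R)"

lemma ae_bounded_integrable: "ae_bounded f \<Longrightarrow> integrable M f"
  unfolding ae_bounded_def by (auto intro!: integrable_const_bound)

lemma ae_bounded_dominated:
  assumes "f \<in> borel_measurable M" "ae_bounded g" "\<And>\<omega>. \<bar>f \<omega>\<bar> \<le> g \<omega>"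
  shows "ae_bounded f"
proof -
  obtain R where "AE \<omega> in M. \<bar>g \<omega>\<bar> \<le> R"
    using assms(2) by (auto simp: ae_bounded_def)
  then have "AE \<omega> in M. \<bar>f \<omega>\<bar> \<le> R"
    by eventually_elim (use assms(3) in \<open>smt (verit)\<close>)
  with assms(1) show ?thesis
    by (auto simp: ae_bounded_def)
qed

lemma ae_bounded_const: "ae_bounded (\<lambda>_. c)"
  by (auto simp: ae_bounded_def)

lemma ae_bounded_add:
  assumes "ae_bounded f" "ae_bounded g"
  shows "ae_bounded (\<lambda>\<omega>. f \<omega> + g \<omega>)"
proof -
  obtain R Q where "AE \<omega> in M. \<bar>f \<omega>\<bar> \<le> R" "AE \<omega> in M. \<bar>g \<omega>\<bar> \<le> Q"
    using assms by (auto simp: ae_bounded_def)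
  then have "AE \<omega> in M. \<bar>f \<omega> + g \<omega>\<bar> \<le> R + Q"
    by eventually_elim linarith
  with assms show ?thesis
    by (auto simp: ae_bounded_def)
qed

lemma ae_bounded_mult:
  assumes "ae_bounded f" "ae_bounded g"
  shows "ae_bounded (\<lambda>\<omega>. f \<omega> * g \<omega>)"
proof -
  obtain R Q where "AE \<omega> in M. \<bar>f \<omega>\<bar> \<le> R" "AE \<omega> in M. \<bar>g \<omega>\<bar> \<le> Q"
    using assms by (auto simp: ae_bounded_def)
  then have "AE \<omega> in M. \<bar>f \<omega> * g \<omega>\<bar> \<le> R * Q"
    by eventually_elim (auto simp: abs_mult intro!: mult_mono)
  with assms show ?thesis
    by (auto simp: ae_bounded_def)
qed

lemma ae_bounded_sum: "(\<And>i. i \<in> I \<Longrightarrow> ae_bounded (f i)) \<Longrightarrow> ae_bounded (\<lambda>\<omega>. \<Sum>i\<in>I. f i \<omega>)"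
  by (induction I rule: infinite_finite_induct) (auto intro: ae_bounded_add ae_bounded_const)

lemma ae_bounded_cosh:
  assumes "ae_bounded f"
  shows "ae_bounded (\<lambda>\<omega>. cosh (f \<omega>))"
proof -
  obtain R where "AE \<omega> in M. \<bar>f \<omega>\<bar> \<le> R"
    using assms by (auto simp: ae_bounded_def)
  then have "AE \<omega> in M. \<bar>cosh (f \<omega>)\<bar> \<le> cosh R"
  proof eventually_elim
    case (elim \<omega>)
    then have "cosh \<bar>f \<omega>\<bar> \<le> cosh R"
      by (subst cosh_real_nonneg_le_iff) auto
    then show ?case by simp
  qed
  moreover have "(\<lambda>\<omega>. cosh (f \<omega>)) \<in> borel_measurable M"
  proof -
    have [measurable]: "f \<in> borel_measurable M"
      using assms by (simp add: ae_bounded_def)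
    show ?thesis
      unfolding cosh_field_def by measurable
  qed
  ultimately show ?thesis
    by (auto simp: ae_bounded_def)
qed

lemma ae_bounded_sinh:
  assumes "ae_bounded f"
  shows "ae_bounded (\<lambda>\<omega>. sinh (f \<omega>))"
proof (rule ae_bounded_dominated[OF _ ae_bounded_cosh[OF assms]])
  have [measurable]: "f \<in> borel_measurable M"
    using assms by (simp add: ae_bounded_def)
  show "(\<lambda>\<omega>. sinh (f \<omega>)) \<in> borel_measurable M"
    unfolding sinh_field_def by measurable
qed (rule abs_sinh_le_cosh)

lemma stationary_distr:
  assumes "finite J"
  shows "distr M (PiM J (\<lambda>_. borel)) (\<lambda>\<omega>. restrict (\<lambda>j. eps j \<omega>) J) =
    distr M (PiM J (\<lambda>_. borel)) (\<lambda>\<omega>. restrict (\<lambda>j. eps (j + k) \<omega>) J)"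
  using stationary assms by (auto simp: strictly_stationary_def)

lemma stationary_integral:
  fixes f :: "((int, 'd) vec \<Rightarrow> real) \<Rightarrow> real"
  assumes "finite J" and [measurable]: "f \<in> borel_measurable (PiM J (\<lambda>_. borel))"
  shows "(\<integral>\<omega>. f (restrict (\<lambda>j. eps j \<omega>) J) \<partial>M) = (\<integral>\<omega>. f (restrict (\<lambda>j. eps (j + k) \<omega>) J) \<partial>M)"
proof -
  have "(\<integral>\<omega>. f (restrict (\<lambda>j. eps j \<omega>) J) \<partial>M) =
      (\<integral>v. f v \<partial>distr M (PiM J (\<lambda>_. borel)) (\<lambda>\<omega>. restrict (\<lambda>j. eps j \<omega>) J))"
    by (subst integral_distr) auto
  also have "\<dots> = (\<integral>v. f v \<partial>distr M (PiM J (\<lambda>_. borel)) (\<lambda>\<omega>. restrict (\<lambda>j. eps (j + k) \<omega>) J))"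
    using stationary_distr[OF assms(1), of k] by simp
  also have "\<dots> = (\<integral>\<omega>. f (restrict (\<lambda>j. eps (j + k) \<omega>) J) \<partial>M)"
    by (subst integral_distr) auto
  finally show ?thesis .
qed

lemma integral_eps: "(\<integral>\<omega>. eps i \<omega> \<partial>M) = (\<integral>\<omega>. eps 0 \<omega> \<partial>M)"
  using stationary_integral[of "{0}" "\<lambda>v. v 0" i] by simp

lemma integral_cosh_shift:
  assumes "finite W"
  shows "(\<integral>\<omega>. cosh (\<Sum>j\<in>W. a j * eps j \<omega>) \<partial>M) = (\<integral>\<omega>. cosh (\<Sum>j\<in>W. a j * eps (j + k) \<omega>) \<partial>M)"
proof -
  have meas: "(\<lambda>v. cosh (\<Sum>j\<in>W. a j * v j)) \<in> borel_measurable (PiM W (\<lambda>_. borel :: real measure))"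
    unfolding cosh_field_def by measurable
  show ?thesis
    using stationary_integral[OF assms meas, of k] by simp
qed

text \<open>Being bounded by \<open>B\<close> is an event of the one-dimensional marginal, which
  stationarity makes the same at every site.\<close>

lemma eps_bounded: "AE \<omega> in M. \<bar>eps i \<omega>\<bar> \<le> B"
proof -
  have m: "{v \<in> space (PiM {0} (\<lambda>_. borel)). \<bar>v 0\<bar> \<le> B}
      \<in> sets (PiM {0 :: (int, 'd) vec} (\<lambda>_. borel :: real measure))"
    by measurable
  have "AE v in distr M (PiM {0} (\<lambda>_. borel)) (\<lambda>\<omega>. restrict (\<lambda>j. eps j \<omega>) {0}). \<bar>v 0\<bar> \<le> B"
    using eps_0_bounded by (subst AE_distr_iff[OF _ m]) (auto simp del: PiM_empty)
  then have "AE v in distr M (PiM {0} (\<lambda>_. borel)) (\<lambda>\<omega>. restrict (\<lambda>j. eps (j + i) \<omega>) {0}). \<bar>v 0\<bar> \<le> B"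
    by (simp only: stationary_distr[of "{0}" i, OF finite.insertI[OF finite.emptyI]])
  then show ?thesis
    by (subst (asm) AE_distr_iff[OF _ m]) auto
qed

lemma B_nonneg: "B \<ge> 0"
proof -
  have "AE \<omega> in M. 0 \<le> B"
    using eps_0_bounded by eventually_elim linarith
  then show ?thesis by simp
qed

lemma ae_bounded_eps: "ae_bounded (eps i)"
  using eps_bounded[of i] by (auto simp: ae_bounded_def)

lemma ae_bounded_lincomb: "ae_bounded (\<lambda>\<omega>. \<Sum>i\<in>I. a i * eps i \<omega>)"
  by (intro ae_bounded_sum ae_bounded_mult ae_bounded_const ae_bounded_eps)

section \<open>The dependence coefficients of (C1) and the exponential moment bound\<close>

text \<open>The summand of (C1) as a real number. Since \<open>real_of_ereal\<close> sends infinity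
  to 0, it is meaningful only together with finiteness of \<open>linf\<close>, which the lemmas
  below assume.\<close>

definition delta :: "(int, 'd) vec \<Rightarrow> real" where
  "delta k = real_of_ereal (linf M (\<lambda>\<omega>. eps k \<omega> *
     real_cond_exp M (field_sigma M eps (Vset (inorm k))) (eps 0) \<omega>))"

lemma
  assumes "linf M (\<lambda>\<omega>. eps k \<omega> * real_cond_exp M (field_sigma M eps (Vset (inorm k))) (eps 0) \<omega>) < \<infinity>"
  shows delta_bound: "AE \<omega> in M. \<bar>eps k \<omega> *
      real_cond_exp M (field_sigma M eps (Vset (inorm k))) (eps 0) \<omega>\<bar> \<le> delta k"
    and delta_nonneg: "delta k \<ge> 0"
proof -
  define f where "f = (\<lambda>\<omega>. eps k \<omega> * real_cond_exp M (field_sigma M eps (Vset (inorm k))) (eps 0) \<omega>)"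
  have AE: "AE \<omega> in M. ereal \<bar>f \<omega>\<bar> \<le> linf M f"
    unfolding linf_def by (rule esssup_AE)
  \<comment> \<open>An almost sure statement that does not depend on \<open>\<omega>\<close> holds
    outright on a probability space.\<close>
  then have "AE \<omega> in M. 0 \<le> linf M f"
    by eventually_elim (auto elim: order_trans[rotated])
  then have nonneg: "0 \<le> linf M f" by simp
  then have "linf M f = ereal (delta k)"
    using assms unfolding delta_def f_def by (cases "linf M f") (auto simp: f_def)
  with AE nonneg show "AE \<omega> in M. \<bar>eps k \<omega> *
      real_cond_exp M (field_sigma M eps (Vset (inorm k))) (eps 0) \<omega>\<bar> \<le> delta k" "delta k \<ge> 0"
    by (auto simp: f_def)
qed

text \<open>Peeling off the site \<open>k\<close> closest to the origin leaves only sites that generate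
  the \<open>\<sigma>\<close>-algebra attached to \<open>k\<close> in condition (C1).\<close>

lemma covariance_sinh_le:
  assumes fin: "\<And>k. k \<in> Vset 1 \<Longrightarrow> linf M (\<lambda>\<omega>. eps k \<omega> *
      real_cond_exp M (field_sigma M eps (Vset (inorm k))) (eps 0) \<omega>) < \<infinity>"
    and U: "finite U" "U \<subseteq> Vset 1"
    and a: "\<And>k. k \<in> U \<Longrightarrow> \<bar>a k\<bar> \<le> th"
    and H: "\<And>T. T \<subseteq> U \<Longrightarrow> (\<integral>\<omega>. cosh (\<Sum>k\<in>T. a k * eps k \<omega>) \<partial>M) \<le> H"
  shows "\<bar>\<integral>\<omega>. eps 0 \<omega> * sinh (\<Sum>k\<in>U. a k * eps k \<omega>) \<partial>M\<bar> \<le> 2 * th * H * (\<Sum>k\<in>U. delta k)"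
  using U a H
\<comment> \<open>Ranking by the negative norm makes the inserted \<open>x\<close> a site of least
  norm. Ties do no harm, because \<open>Vset\<close> asks only for distance at least
  \<open>inorm x\<close>. The inserted site may already belong to \<open>S\<close>, hence the case
  distinction.\<close>
proof (induction rule: finite_ranking_induct[where f = "\<lambda>k. - inorm k"])
  case empty
  then show ?case by simp
next
  case (insert x S)
  show ?case
  proof (cases "x \<in> S")
    case True
    then show ?thesis
      using insert by (simp add: insert_absorb)
  next
    case False
    define F where "F = field_sigma M eps (Vset (inorm x))"
    define T where "T \<omega> = (\<Sum>k\<in>S. a k * eps k \<omega>)" for \<omega>
    define Y where "Y \<omega> = a x * eps x \<omega>" for \<omega>
    \<comment> \<open>The difference quotient turns the increment of \<open>sinh\<close> into
      \<open>Y * q\<close>, which exposes the factor \<open>eps x\<close> that (C1) pairs with the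
      conditional expectation. Where \<open>Y\<close> vanishes, \<open>q\<close> is 0 and the
      identity still holds.\<close>
    define q where "q \<omega> = (sinh (T \<omega> + Y \<omega>) - sinh (T \<omega>)) / Y \<omega>" for \<omega>
    define E where "E = real_cond_exp M F (eps 0)"
    have x: "x \<in> Vset 1" and S: "S \<subseteq> Vset 1"
      using insert.prems by auto
    have th: "\<bar>a x\<bar> \<le> th" and "th \<ge> 0"
      using insert.prems(2)[of x] by auto
    have sum_insert: "(\<Sum>k\<in>insert x S. a k * eps k \<omega>) = T \<omega> + Y \<omega>" for \<omega>
      using False insert.hyps by (simp add: T_def Y_def)
    have near: "insert x S \<subseteq> Vset (inorm x)"
      using insert.hyps(2) x S by (auto simp: Vset_def)
    have bT: "ae_bounded T" and bY: "ae_bounded Y"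
      unfolding T_def Y_def by (intro ae_bounded_lincomb ae_bounded_mult ae_bounded_const ae_bounded_eps)+
    \<comment> \<open>All sites occurring in \<open>q\<close> lie in \<open>Vset (inorm x)\<close>
      by \<open>near\<close>, so \<open>eps x\<close> times \<open>q\<close> may be moved across the
      conditional expectation given \<open>F\<close>.\<close>
    have qF: "q \<in> borel_measurable F" and epsF: "eps x \<in> borel_measurable F"
    proof -
      have 1: "eps k \<in> borel_measurable F" if "k \<in> insert x S" for k
        unfolding F_def using that near by (intro measurable_field_sigma) auto
      have 2: "T \<in> borel_measurable F" "Y \<in> borel_measurable F"
        unfolding T_def Y_def using 1 by (auto intro!: borel_measurable_sum)
      then show "q \<in> borel_measurable F"
        unfolding q_def sinh_field_def by measurable
      show "eps x \<in> borel_measurable F"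
        using 1 by simp
    qed
    have sub: "subalgebra M F"
      unfolding F_def by (intro subalgebra_field_sigma) simp
    interpret F: finite_measure_subalgebra M F
      by unfold_locales (rule sub)
    have qM: "q \<in> borel_measurable M"
      using measurable_from_subalg[OF sub qF] .
    have bTY: "ae_bounded (\<lambda>\<omega>. T \<omega> + Y \<omega>)"
      using ae_bounded_add[OF bT bY] .
    have bq: "ae_bounded q"
      by (rule ae_bounded_dominated[OF qM ae_bounded_add[OF ae_bounded_cosh[OF bT] ae_bounded_cosh[OF bTY]]])
        (simp only: q_def sinh_slope_le)
    \<comment> \<open>One \<open>H\<close> comes from \<open>S\<close> and one from
      \<open>insert x S\<close>; this is why the hypothesis on \<open>H\<close> covers all subsets
      of \<open>U\<close>.\<close>
    have intq: "(\<integral>\<omega>. \<bar>q \<omega>\<bar> \<partial>M) \<le> 2 * H"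
    proof -
      have "(\<integral>\<omega>. \<bar>q \<omega>\<bar> \<partial>M) \<le> (\<integral>\<omega>. cosh (T \<omega>) + cosh (T \<omega> + Y \<omega>) \<partial>M)"
      proof (rule integral_mono)
        show "integrable M (\<lambda>\<omega>. \<bar>q \<omega>\<bar>)"
          using ae_bounded_integrable[OF bq] by (rule integrable_abs)
        show "integrable M (\<lambda>\<omega>. cosh (T \<omega>) + cosh (T \<omega> + Y \<omega>))"
          by (rule ae_bounded_integrable[OF ae_bounded_add[OF ae_bounded_cosh[OF bT] ae_bounded_cosh[OF bTY]]])
      qed (simp only: q_def sinh_slope_le)
      also have "\<dots> = (\<integral>\<omega>. cosh (T \<omega>) \<partial>M) + (\<integral>\<omega>. cosh (T \<omega> + Y \<omega>) \<partial>M)"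
        using bT bTY by (intro Bochner_Integration.integral_add ae_bounded_integrable ae_bounded_cosh)
      also have "\<dots> \<le> H + H"
        using insert.prems(3)[of S] insert.prems(3)[of "insert x S"] 
        by (intro add_mono) (auto simp: T_def sum_insert)
      finally show ?thesis by simp
    qed
    have split: "eps 0 \<omega> * sinh (T \<omega> + Y \<omega>) = eps 0 \<omega> * sinh (T \<omega>) + a x * (eps x \<omega> * q \<omega> * eps 0 \<omega>)" for \<omega>
    proof -
      have "sinh (T \<omega> + Y \<omega>) = sinh (T \<omega>) + Y \<omega> * q \<omega>"
        by (simp add: q_def)
      then show ?thesis
        by (simp add: Y_def algebra_simps)
    qed
    have i1: "integrable M (\<lambda>\<omega>. eps 0 \<omega> * sinh (T \<omega>))"
      using bT by (intro ae_bounded_integrable ae_bounded_mult ae_bounded_eps ae_bounded_sinh)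
    have i2: "integrable M (\<lambda>\<omega>. eps x \<omega> * q \<omega> * eps 0 \<omega>)"
      using bq by (intro ae_bounded_integrable ae_bounded_mult ae_bounded_eps)
    have fF: "(\<lambda>\<omega>. eps x \<omega> * q \<omega>) \<in> borel_measurable F"
      using qF epsF by measurable
    \<comment> \<open>Conditioning on \<open>F\<close> replaces \<open>eps 0\<close> by
      \<open>E\<close>; the product of \<open>eps x\<close> and \<open>E\<close> is then at most
      \<open>delta x\<close> in modulus, and \<open>q\<close> contributes its first absolute
      moment.\<close>
    have "\<bar>\<integral>\<omega>. eps x \<omega> * q \<omega> * eps 0 \<omega> \<partial>M\<bar> = \<bar>\<integral>\<omega>. eps x \<omega> * q \<omega> * E \<omega> \<partial>M\<bar>"
      unfolding E_def by (subst F.real_cond_exp_intg(2)[OF i2 fF]) auto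
    also have "\<dots> \<le> (\<integral>\<omega>. \<bar>eps x \<omega> * q \<omega> * E \<omega>\<bar> \<partial>M)"
      by (rule integral_abs_bound)
    also have "\<dots> \<le> (\<integral>\<omega>. delta x * \<bar>q \<omega>\<bar> \<partial>M)"
    proof (rule integral_mono_AE)
      show "integrable M (\<lambda>\<omega>. \<bar>eps x \<omega> * q \<omega> * E \<omega>\<bar>)"
        unfolding E_def by (intro integrable_abs F.real_cond_exp_intg(1)[OF i2 fF]) auto
      show "integrable M (\<lambda>\<omega>. delta x * \<bar>q \<omega>\<bar>)"
        using bq by (intro integrable_mult_right integrable_abs ae_bounded_integrable)
      show "AE \<omega> in M. \<bar>eps x \<omega> * q \<omega> * E \<omega>\<bar> \<le> delta x * \<bar>q \<omega>\<bar>"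
        using delta_bound[OF fin[OF x]]
      proof eventually_elim
        case (elim \<omega>)
        then have "\<bar>eps x \<omega> * E \<omega>\<bar> * \<bar>q \<omega>\<bar> \<le> delta x * \<bar>q \<omega>\<bar>"
          by (intro mult_right_mono) (auto simp: E_def F_def)
        then show ?case
          by (simp add: abs_mult mult_ac)
      qed
    qed
    also have "\<dots> \<le> delta x * (2 * H)"
      using intq delta_nonneg[OF fin[OF x]] by (simp add: mult_left_mono)
    finally have *: "\<bar>\<integral>\<omega>. eps x \<omega> * q \<omega> * eps 0 \<omega> \<partial>M\<bar> \<le> delta x * (2 * H)" .
    have "\<bar>\<integral>\<omega>. eps 0 \<omega> * sinh (\<Sum>k\<in>insert x S. a k * eps k \<omega>) \<partial>M\<bar> =
        \<bar>(\<integral>\<omega>. eps 0 \<omega> * sinh (T \<omega>) \<partial>M) + a x * (\<integral>\<omega>. eps x \<omega> * q \<omega> * eps 0 \<omega> \<partial>M)\<bar>"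
      unfolding sum_insert split
      by (subst Bochner_Integration.integral_add) (use i1 i2 in auto)
    also have "\<dots> \<le> \<bar>\<integral>\<omega>. eps 0 \<omega> * sinh (T \<omega>) \<partial>M\<bar> + \<bar>a x\<bar> * \<bar>\<integral>\<omega>. eps x \<omega> * q \<omega> * eps 0 \<omega> \<partial>M\<bar>"
      by (rule order_trans[OF abs_triangle_ineq]) (simp add: abs_mult)
    also have "\<dots> \<le> 2 * th * H * (\<Sum>k\<in>S. delta k) + th * (delta x * (2 * H))"
    proof (intro add_mono mult_mono)
      show "\<bar>\<integral>\<omega>. eps 0 \<omega> * sinh (T \<omega>) \<partial>M\<bar> \<le> 2 * th * H * (\<Sum>k\<in>S. delta k)"
        unfolding T_def using insert.prems by (intro insert.IH) auto
    qed (use th * \<open>th \<ge> 0\<close> in auto)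
    also have "\<dots> = 2 * th * H * (\<Sum>k\<in>insert x S. delta k)"
      using False insert.hyps by (simp add: algebra_simps)
    finally show ?thesis .
  qed
qed

text \<open>Each site costs a factor \<open>exp (th\<^sup>2 * (B\<^sup>2 + 2 * D))\<close>: the
  square of the last site gives \<open>B\<^sup>2\<close>, its covariance with the earlier sites
  gives \<open>2 * D\<close>.\<close>

lemma cosh_moment_le:
  assumes fin: "\<And>k. k \<in> Vset 1 \<Longrightarrow> linf M (\<lambda>\<omega>. eps k \<omega> *
      real_cond_exp M (field_sigma M eps (Vset (inorm k))) (eps 0) \<omega>) < \<infinity>"
    and D: "\<And>U. finite U \<Longrightarrow> U \<subseteq> Vset 1 \<Longrightarrow> (\<Sum>k\<in>U. delta k) \<le> D"
    and "finite W" and "\<And>i. i \<in> W \<Longrightarrow> \<bar>a i\<bar> \<le> th" and "th \<ge> 0"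
  shows "(\<integral>\<omega>. cosh (\<Sum>i\<in>W. a i * eps i \<omega>) \<partial>M) \<le> exp (th\<^sup>2 * (B\<^sup>2 + 2 * D) * card W)"
  using assms(3,4)
proof (induction "card W" arbitrary: W a)
  case 0
  then show ?case by (simp add: prob_space)
next
  case (Suc n)
  have "D \<ge> 0"
    using D[of "{}"] by simp
  define L where "L = B\<^sup>2 + 2 * D"
  have L: "L \<ge> 0"
    using \<open>D \<ge> 0\<close> by (simp add: L_def)
  define H where "H = exp (th\<^sup>2 * L * n)"
  from Suc have "W \<noteq> {}" by auto
  then obtain i where i: "i \<in> W" "\<And>j. j \<in> W \<Longrightarrow> j \<noteq> i \<Longrightarrow> lexless j i"
    using finite_lexless_maximal[OF \<open>finite W\<close>] by blast
  define U where "U = (\<lambda>j. j - i) ` (W - {i})"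
  define b where "b j = a (j + i)" for j
  have inj: "inj_on (\<lambda>j. j - i) A" for A
    by (auto simp: inj_on_def)
  have U: "finite U" "U \<subseteq> Vset 1"
  proof -
    show "finite U"
      using Suc.prems(1) by (auto simp: U_def)
    show "U \<subseteq> Vset 1"
      unfolding U_def by (rule image_subsetI) (use i(2) in \<open>simp add: mem_Vset_1 lexless_diff\<close>)
  qed
  have cardU: "card U = n"
    using Suc i unfolding U_def by (subst card_image[OF inj]) auto
  have b: "\<bar>b k\<bar> \<le> th" if "k \<in> insert 0 U" for k
    using that Suc.prems i by (auto simp: U_def b_def)
  have sum_shift: "(\<Sum>j\<in>W. a j * eps (j + - i) \<omega>) = (\<Sum>k\<in>U. b k * eps k \<omega>) + b 0 * eps 0 \<omega>" for \<omega>
  proof -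
    have "(\<Sum>k\<in>U. b k * eps k \<omega>) = (\<Sum>j\<in>W - {i}. a j * eps (j - i) \<omega>)"
      unfolding U_def b_def by (subst sum.reindex[OF inj]) simp
    moreover have "(\<Sum>j\<in>W. a j * eps (j + - i) \<omega>) = a i * eps 0 \<omega> + (\<Sum>j\<in>W - {i}. a j * eps (j - i) \<omega>)"
      using i Suc.prems by (subst sum.remove[of _ i]) auto
    ultimately show ?thesis
      by (simp add: b_def)
  qed
  have IH: "(\<integral>\<omega>. cosh (\<Sum>k\<in>T. b k * eps k \<omega>) \<partial>M) \<le> H" if "T \<subseteq> U" for T
  proof -
    \<comment> \<open>Coefficients outside \<open>T\<close> are set to 0 instead of removing sites,
      so the induction hypothesis for \<open>n\<close> sites serves every subset at once.\<close>
    have "(\<Sum>k\<in>T. b k * eps k \<omega>) = (\<Sum>k\<in>U. (if k \<in> T then b k else 0) * eps k \<omega>)" for \<omega>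
      using that U by (intro sum.mono_neutral_cong_left) auto
    moreover have "(\<integral>\<omega>. cosh (\<Sum>k\<in>U. (if k \<in> T then b k else 0) * eps k \<omega>) \<partial>M) \<le> exp (th\<^sup>2 * (B\<^sup>2 + 2 * D) * card U)"
      using U b cardU \<open>th \<ge> 0\<close> by (intro Suc.hyps(1)) auto
    ultimately show ?thesis
      by (simp add: H_def L_def cardU)
  qed
  define S where "S \<omega> = (\<Sum>k\<in>U. b k * eps k \<omega>)" for \<omega>
  have bS: "ae_bounded S"
    unfolding S_def by (rule ae_bounded_lincomb)
  have i1: "integrable M (\<lambda>\<omega>. cosh (S \<omega>) * exp (th\<^sup>2 * B\<^sup>2))"
    using bS by (intro ae_bounded_integrable ae_bounded_mult ae_bounded_cosh ae_bounded_const)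
  have i2: "integrable M (\<lambda>\<omega>. b 0 * (eps 0 \<omega> * sinh (S \<omega>)))"
    using bS by (intro ae_bounded_integrable ae_bounded_mult ae_bounded_sinh ae_bounded_const ae_bounded_eps)
  have "(\<integral>\<omega>. cosh (\<Sum>i\<in>W. a i * eps i \<omega>) \<partial>M) = (\<integral>\<omega>. cosh (S \<omega> + b 0 * eps 0 \<omega>) \<partial>M)"
    using integral_cosh_shift[OF \<open>finite W\<close>, of a "- i"] by (simp only: sum_shift S_def)
  also have "\<dots> \<le> (\<integral>\<omega>. cosh (S \<omega>) * exp (th\<^sup>2 * B\<^sup>2) + b 0 * (eps 0 \<omega> * sinh (S \<omega>)) \<partial>M)"
  proof (rule integral_mono_AE)
    show "integrable M (\<lambda>\<omega>. cosh (S \<omega> + b 0 * eps 0 \<omega>))"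
      using bS by (intro ae_bounded_integrable ae_bounded_cosh ae_bounded_add ae_bounded_mult
          ae_bounded_const ae_bounded_eps)
    show "AE \<omega> in M. cosh (S \<omega> + b 0 * eps 0 \<omega>) \<le> cosh (S \<omega>) * exp (th\<^sup>2 * B\<^sup>2) + b 0 * (eps 0 \<omega> * sinh (S \<omega>))"
      using eps_0_bounded
    proof eventually_elim
      case (elim \<omega>)
      have "\<bar>b 0 * eps 0 \<omega>\<bar> \<le> th * B"
        unfolding abs_mult using elim b[of 0] \<open>th \<ge> 0\<close> by (intro mult_mono) auto
      then have "(b 0 * eps 0 \<omega>)\<^sup>2 \<le> th\<^sup>2 * B\<^sup>2"
        by (metis abs_ge_zero power2_abs power_mono power_mult_distrib)
      then have "cosh (S \<omega>) * exp ((b 0 * eps 0 \<omega>)\<^sup>2) \<le> cosh (S \<omega>) * exp (th\<^sup>2 * B\<^sup>2)"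
        by (intro mult_left_mono) auto
      then show ?case
        using cosh_add_le[of "S \<omega>" "b 0 * eps 0 \<omega>"] unfolding mult.assoc by linarith
    qed
  qed (use i1 i2 in auto)
  also have "\<dots> = (\<integral>\<omega>. cosh (S \<omega>) \<partial>M) * exp (th\<^sup>2 * B\<^sup>2) + b 0 * (\<integral>\<omega>. eps 0 \<omega> * sinh (S \<omega>) \<partial>M)"
    by (subst Bochner_Integration.integral_add[OF i1 i2]) simp
  also have "\<dots> \<le> H * exp (th\<^sup>2 * B\<^sup>2) + th * (2 * th * H * D)"
  proof (rule add_mono)
    show "(\<integral>\<omega>. cosh (S \<omega>) \<partial>M) * exp (th\<^sup>2 * B\<^sup>2) \<le> H * exp (th\<^sup>2 * B\<^sup>2)"
      unfolding S_def by (intro mult_right_mono IH) auto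
    have "\<bar>\<integral>\<omega>. eps 0 \<omega> * sinh (S \<omega>) \<partial>M\<bar> \<le> 2 * th * H * (\<Sum>k\<in>U. delta k)"
      unfolding S_def using U b by (intro covariance_sinh_le[OF fin] IH) auto
    also have "\<dots> \<le> 2 * th * H * D"
      using D[of U] U \<open>th \<ge> 0\<close> by (intro mult_left_mono) (auto simp: H_def)
    finally have "\<bar>b 0\<bar> * \<bar>\<integral>\<omega>. eps 0 \<omega> * sinh (S \<omega>) \<partial>M\<bar> \<le> th * (2 * th * H * D)"
      using b[of 0] \<open>th \<ge> 0\<close> by (intro mult_mono) auto
    then show "b 0 * (\<integral>\<omega>. eps 0 \<omega> * sinh (S \<omega>) \<partial>M) \<le> th * (2 * th * H * D)"
      by (simp only: flip: abs_mult)
  qed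
  also have "\<dots> = H * (exp (th\<^sup>2 * B\<^sup>2) + th\<^sup>2 * (2 * D))"
    by (simp add: algebra_simps power2_eq_square)
  also have "\<dots> \<le> H * exp (th\<^sup>2 * L)"
  proof (rule mult_left_mono)
    \<comment> \<open>Enlarging the second summand by a factor at least 1 lets the exponential be
      factored out; \<open>1 + y \<le> exp y\<close> then absorbs the rest.\<close>
    have "exp (th\<^sup>2 * B\<^sup>2) + th\<^sup>2 * (2 * D) \<le> exp (th\<^sup>2 * B\<^sup>2) * (1 + th\<^sup>2 * (2 * D))"
    proof -
      have "1 * (th\<^sup>2 * (2 * D)) \<le> exp (th\<^sup>2 * B\<^sup>2) * (th\<^sup>2 * (2 * D))"
        using \<open>D \<ge> 0\<close> by (intro mult_right_mono) auto
      then show ?thesis by (simp add: algebra_simps)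
    qed
    also have "\<dots> \<le> exp (th\<^sup>2 * B\<^sup>2) * exp (th\<^sup>2 * (2 * D))"
      by (intro mult_left_mono exp_ge_add_one_self) auto
    finally show "exp (th\<^sup>2 * B\<^sup>2) + th\<^sup>2 * (2 * D) \<le> exp (th\<^sup>2 * L)"
      by (simp add: L_def algebra_simps flip: exp_add)
  qed (simp add: H_def)
  also have "\<dots> = exp (th\<^sup>2 * L * card W)"
    unfolding H_def Suc.hyps(2)[symmetric] by (simp add: algebra_simps flip: exp_add)
  finally show ?case
    by (simp add: L_def)
qed

text \<open>Chernoff's method with \<open>cosh\<close> in place of \<open>exp\<close>, which handles
  both signs at once. A separate \<open>L > 0\<close> keeps the quotients meaningful even if
  \<open>B\<close> and \<open>D\<close> vanish.\<close>

lemma tail_bound: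
  assumes fin: "\<And>k. k \<in> Vset 1 \<Longrightarrow> linf M (\<lambda>\<omega>. eps k \<omega> *
      real_cond_exp M (field_sigma M eps (Vset (inorm k))) (eps 0) \<omega>) < \<infinity>"
    and D: "\<And>U. finite U \<Longrightarrow> U \<subseteq> Vset 1 \<Longrightarrow> (\<Sum>k\<in>U. delta k) \<le> D"
    and W: "finite W" "W \<noteq> {}" and a: "\<And>i. i \<in> W \<Longrightarrow> \<bar>a i\<bar> \<le> C"
    and L: "B\<^sup>2 + 2 * D \<le> L" "L > 0" and "C > 0" "t \<ge> 0"
  shows "prob {\<omega> \<in> space M. \<bar>\<Sum>i\<in>W. a i * eps i \<omega>\<bar> \<ge> t} \<le> 2 * exp (- t\<^sup>2 / (4 * C\<^sup>2 * L * card W))"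
proof -
  define N where "N = real (card W)"
  have "N > 0"
    using W by (simp add: N_def card_gt_0_iff)
  \<comment> \<open>The minimiser of \<open>s\<^sup>2 * C\<^sup>2 * L * N - s * t\<close>, with
    minimum \<open>- t\<^sup>2 / (4 * C\<^sup>2 * L * N)\<close>.\<close>
  define s where "s = t / (2 * C\<^sup>2 * L * N)"
  have "s \<ge> 0"
    using assms \<open>N > 0\<close> by (simp add: s_def)
  define S where "S \<omega> = (\<Sum>i\<in>W. (s * a i) * eps i \<omega>)" for \<omega>
  have S: "S \<omega> = s * (\<Sum>i\<in>W. a i * eps i \<omega>)" for \<omega>
    by (simp add: S_def sum_distrib_left mult.assoc)
  have bS: "ae_bounded S"
    unfolding S_def by (rule ae_bounded_lincomb)
  have [measurable]: "S \<in> borel_measurable M"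
    using bS by (simp add: ae_bounded_def)
  have meas_cosh [measurable]: "(\<lambda>\<omega>. cosh (S \<omega>)) \<in> borel_measurable M"
    using ae_bounded_cosh[OF bS] by (simp add: ae_bounded_def)
  have "prob {\<omega> \<in> space M. \<bar>\<Sum>i\<in>W. a i * eps i \<omega>\<bar> \<ge> t} \<le> prob {\<omega> \<in> space M. cosh (S \<omega>) \<ge> exp (s * t) / 2}"
  proof (rule finite_measure_mono)
    show "{\<omega> \<in> space M. \<bar>\<Sum>i\<in>W. a i * eps i \<omega>\<bar> \<ge> t} \<subseteq> {\<omega> \<in> space M. cosh (S \<omega>) \<ge> exp (s * t) / 2}"
    proof safe
      fix \<omega> assume "t \<le> \<bar>\<Sum>i\<in>W. a i * eps i \<omega>\<bar>"
      then have "s * t \<le> \<bar>S \<omega>\<bar>"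
        using \<open>s \<ge> 0\<close> by (simp add: S abs_mult mult_left_mono)
      then have "exp (s * t) / 2 \<le> exp \<bar>S \<omega>\<bar> / 2"
        by simp
      also have "\<dots> \<le> cosh \<bar>S \<omega>\<bar>"
        by (simp add: cosh_field_def del: cosh_real_abs)
      finally show "exp (s * t) / 2 \<le> cosh (S \<omega>)" by simp
    qed
  qed measurable
  also have "\<dots> \<le> (\<integral>\<omega>. cosh (S \<omega>) \<partial>M) / (exp (s * t) / 2)"
    using ae_bounded_integrable[OF ae_bounded_cosh[OF bS]]
    by (intro integral_Markov_inequality_measure[where A = "{}"]) auto
  also have "\<dots> \<le> exp ((s * C)\<^sup>2 * (B\<^sup>2 + 2 * D) * N) / (exp (s * t) / 2)"
    unfolding S_def N_def
    using a \<open>s \<ge> 0\<close> \<open>C > 0\<close> W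
    by (intro divide_right_mono cosh_moment_le[OF fin D]) (auto simp: abs_mult intro!: mult_left_mono)
  also have "\<dots> \<le> exp ((s * C)\<^sup>2 * L * N) / (exp (s * t) / 2)"
    using L \<open>N > 0\<close> by (intro divide_right_mono) (auto intro!: mult_right_mono mult_left_mono)
  also have "\<dots> = 2 * exp ((s * C)\<^sup>2 * L * N - s * t)"
    by (simp add: exp_diff)
  also have "(s * C)\<^sup>2 * L * N - s * t = - t\<^sup>2 / (4 * C\<^sup>2 * L * N)"
    using \<open>N > 0\<close> \<open>C > 0\<close> \<open>L > 0\<close> by (simp add: s_def field_simps power2_eq_square)
  finally show ?thesis
    by (simp add: N_def)
qed

end

section \<open>Windows and kernel weights\<close>

lemma rnorm_le_iff: "rnorm x \<le> r \<longleftrightarrow> (\<forall>l. \<bar>x $ l\<bar> \<le> r)"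
  by (simp add: rnorm_def)

lemma card_vec_box:
  fixes A :: "'d::finite \<Rightarrow> 'b set"
  shows "card {v :: ('b, 'd) vec. \<forall>l. v $ l \<in> A l} = (\<Prod>l\<in>UNIV. card (A l))"
proof -
  have "bij_betw vec_nth {v :: ('b, 'd) vec. \<forall>l. v $ l \<in> A l} (PiE UNIV A)"
    by (rule bij_betwI[where g = vec_lambda]) auto
  then have "card {v :: ('b, 'd) vec. \<forall>l. v $ l \<in> A l} = card (PiE UNIV A)"
    by (rule bij_betw_same_card)
  also have "\<dots> = (\<Prod>l\<in>UNIV. card (A l))"
    by (rule card_PiE) simp
  finally show ?thesis .
qed

lemma finite_Lambda: "finite (Lambda n :: (int, 'd::finite) vec set)"
proof -
  have "finite (PiE (UNIV :: 'd set) (\<lambda>_. {1..int n}))"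
    by (intro finite_PiE) auto
  then have "finite (vec_lambda ` PiE (UNIV :: 'd set) (\<lambda>_. {1..int n}))"
    by (rule finite_imageI)
  moreover have "Lambda n \<subseteq> vec_lambda ` PiE (UNIV :: 'd set) (\<lambda>_. {1..int n})"
  proof
    fix i :: "(int, 'd) vec" assume "i \<in> Lambda n"
    then have "vec_nth i \<in> PiE UNIV (\<lambda>_. {1..int n})"
      by (auto simp: Lambda_def)
    then show "i \<in> vec_lambda ` PiE UNIV (\<lambda>_. {1..int n})"
      by (metis image_eqI vec_nth_inverse)
  qed
  ultimately show ?thesis
    by (rule finite_subset[rotated])
qed

text \<open>For \<open>r = h n\<close> these are the design points whose kernel argument falls into
  the support cube.\<close>

definition window :: "nat \<Rightarrow> real \<Rightarrow> (real, 'd::finite) vec \<Rightarrow> (int, 'd) vec set" where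
  "window n r x = {i \<in> Lambda n. \<forall>l. \<bar>x $ l - real_of_int (i $ l) / real n\<bar> \<le> r}"

lemma finite_window: "finite (window n r x)"
  by (rule finite_subset[OF _ finite_Lambda[of n]]) (auto simp: window_def)

lemma card_window_1d:
  fixes x r :: real
  assumes "0 \<le> x" "x \<le> 1" "r \<le> 1 / 2" "real n * r \<ge> 2"
  shows "real n * r / 2 \<le> real (card {i::int. 1 \<le> i \<and> i \<le> int n \<and> \<bar>x - real_of_int i / real n\<bar> \<le> r})"
    (is "_ \<le> real (card ?A)")
proof -
  have n: "n > 0"
    using assms by (cases n) auto
  have fin: "finite ?A"
    by (rule finite_subset[of _ "{1..int n}"]) auto
  have r: "r > 0"
    using assms n by (smt (verit) mult_nonneg_nonpos of_nat_0_le_iff)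
  have key: "real n * r / 2 \<le> real (card ?A)"
    if lo: "0 \<le> u" and hi: "u + real n * r \<le> real n" and near: "u = real n * x \<or> u = real n * x - real n * r" for u
  proof -
    \<comment> \<open>Starting strictly above \<open>u \<ge> 0\<close> excludes the index 0, which
      is no design point.\<close>
    have "{\<lfloor>u\<rfloor> + 1..\<lfloor>u + real n * r\<rfloor>} \<subseteq> ?A"
    proof
      fix i assume "i \<in> {\<lfloor>u\<rfloor> + 1..\<lfloor>u + real n * r\<rfloor>}"
      then have i: "u < real_of_int i" "real_of_int i \<le> u + real n * r"
        by (auto simp: le_floor_iff) linarith
      then have "\<bar>real n * x - real_of_int i\<bar> \<le> real n * r"
        using near by auto
      moreover have "\<bar>real n * x - real_of_int i\<bar> = real n * \<bar>x - real_of_int i / real n\<bar>"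
      proof -
        have "real n * x - real_of_int i = real n * (x - real_of_int i / real n)"
          using n by (simp add: field_simps)
        then show ?thesis
          by (simp add: abs_mult)
      qed
      ultimately have "\<bar>x - real_of_int i / real n\<bar> \<le> r"
        using n by simp
      moreover have "1 \<le> i" "i \<le> int n"
        using i lo hi by linarith+
      ultimately show "i \<in> ?A" by simp
    qed
    then have "card {\<lfloor>u\<rfloor> + 1..\<lfloor>u + real n * r\<rfloor>} \<le> card ?A"
      by (rule card_mono[OF fin])
    moreover have "real n * r / 2 \<le> real (card {\<lfloor>u\<rfloor> + 1..\<lfloor>u + real n * r\<rfloor>})"
      using assms(4) by simp linarith
    ultimately show ?thesis by linarith
  qed
  show ?thesis
  proof (cases "x \<le> 1 / 2")
    case True
    have "real n * (x + r) \<le> real n * 1"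
      using True assms by (intro mult_left_mono) auto
    then show ?thesis
      using assms n by (intro key[of "real n * x"]) (auto simp: algebra_simps)
  next
    case False
    have "real n * 0 \<le> real n * (x - r)" "real n * x \<le> real n * 1"
      using False assms by (intro mult_left_mono; simp)+
    then show ?thesis
      by (intro key[of "real n * x - real n * r"]) (auto simp: algebra_simps)
  qed
qed

text \<open>In the maximum norm the window is a product of one-dimensional windows.\<close>

lemma card_window:
  fixes x :: "(real, 'd::finite) vec"
  assumes "x \<in> unit_cube" "r \<le> 1 / 2" "real n * r \<ge> 2"
  shows "(real n * r / 2) ^ CARD('d) \<le> real (card (window n r x))"
proof -
  define A where "A l = {i::int. 1 \<le> i \<and> i \<le> int n \<and> \<bar>x $ l - real_of_int i / real n\<bar> \<le> r}" for l
  have "window n r x = {i. \<forall>l. i $ l \<in> A l}"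
    by (auto simp: window_def Lambda_def A_def)
  then have card: "real (card (window n r x)) = (\<Prod>l\<in>UNIV. real (card (A l)))"
    by (simp add: card_vec_box)
  have "(real n * r / 2) ^ CARD('d) = (\<Prod>l\<in>(UNIV :: 'd set). real n * r / 2)"
    by simp
  also have "\<dots> \<le> (\<Prod>l\<in>UNIV. real (card (A l)))"
    using assms unfolding A_def
    by (intro prod_mono conjI card_window_1d) (auto simp: unit_cube_def)
  finally show ?thesis
    by (simp add: card)
qed

text \<open>The kernel jumps at the boundary of its support, so two points are comparable only if they
  see the same design points; a window is determined by the integer parts of its end points,
  hence there are polynomially many.\<close>

lemma finite_net_windows:
  fixes r :: real
  assumes "n > 0" "m > 0" "0 \<le> r" "r \<le> 1"
  shows "\<exists>R \<subseteq> (unit_cube :: (real, 'd::finite) vec set). finite R \<and>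
    card R \<le> ((m + 1) * (2 * n + 1)\<^sup>2) ^ CARD('d) \<and>
    (\<forall>x\<in>unit_cube. \<exists>y\<in>R. window n r x = window n r y \<and> rnorm (x - y) \<le> 1 / real m)"
proof -
  \<comment> \<open>The first entry fixes a coordinate up to \<open>1 / m\<close>; the other two are
    the largest and the smallest integer index within reach.\<close>
  define cell where "cell t = (\<lfloor>real m * t\<rfloor>, \<lfloor>real n * (t + r)\<rfloor>, \<lceil>real n * (t - r)\<rceil>)" for t
  define key where "key x = (\<lambda>l. cell ((x :: (real, 'd) vec) $ l))" for x
  define Q where "Q = {0..int m} \<times> {0..2 * int n} \<times> {- int n..int n}"
  have cell_Q: "cell t \<in> Q" if "0 \<le> t" "t \<le> 1" for t
  proof -
    have "real m * t \<le> real m * 1"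
      using that by (intro mult_left_mono) auto
    moreover have "0 \<le> real m * t"
      using that by simp
    moreover have "0 \<le> real n * (t + r)"
      using that assms by auto
    moreover have "real n * (t + r) \<le> real n * 2"
      using that assms by (intro mult_left_mono) auto
    moreover have "real n * (- 1) \<le> real n * (t - r)" "real n * (t - r) \<le> real n * 1"
      using that assms by (intro mult_left_mono; simp)+
    ultimately show ?thesis
      unfolding cell_def Q_def
      by (auto simp: le_floor_iff floor_le_iff le_ceiling_iff ceiling_le_iff)
  qed
  have Q: "finite Q" "card Q = (m + 1) * (2 * n + 1)\<^sup>2"
    by (auto simp: Q_def card_cartesian_product power2_eq_square nat_add_distrib nat_mult_distrib)
  have sub: "key ` unit_cube \<subseteq> PiE UNIV (\<lambda>_. Q)"
    using cell_Q by (auto simp: key_def unit_cube_def)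
  have fin: "finite (PiE (UNIV :: 'd set) (\<lambda>_. Q))"
    using Q by (intro finite_PiE) auto
  \<comment> \<open>One representative inside the cube for each key that occurs.\<close>
  define R where "R = inv_into unit_cube key ` (key ` unit_cube)"
  have "R \<subseteq> unit_cube"
    unfolding R_def by (auto intro: inv_into_into)
  moreover have "finite R"
    unfolding R_def using finite_subset[OF sub fin] by simp
  moreover have "card R \<le> ((m + 1) * (2 * n + 1)\<^sup>2) ^ CARD('d)"
  proof -
    have "card R \<le> card (key ` unit_cube)"
      unfolding R_def using finite_subset[OF sub fin] by (rule card_image_le)
    also have "\<dots> \<le> card (PiE (UNIV :: 'd set) (\<lambda>_. Q))"
      by (rule card_mono[OF fin sub])
    also have "\<dots> = ((m + 1) * (2 * n + 1)\<^sup>2) ^ CARD('d)"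
      by (simp add: card_PiE Q)
    finally show ?thesis .
  qed
  moreover have "\<exists>y\<in>R. window n r x = window n r y \<and> rnorm (x - y) \<le> 1 / real m"
    if "x \<in> unit_cube" for x
  proof -
    define y where "y = inv_into unit_cube key (key x)"
    have "y \<in> R"
      using that by (auto simp: y_def R_def)
    have "key y = key x"
      unfolding y_def using that by (intro f_inv_into_f) auto
    then have cell: "cell (x $ l) = cell (y $ l)" for l
      by (metis key_def)
    have window_iff: "\<bar>t - real_of_int i / real n\<bar> \<le> r \<longleftrightarrow>
        i \<le> \<lfloor>real n * (t + r)\<rfloor> \<and> \<lceil>real n * (t - r)\<rceil> \<le> i" for t i
      using \<open>n > 0\<close> by (auto simp: le_floor_iff ceiling_le_iff abs_le_iff field_simps)
    have "window n r x = window n r y"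
      unfolding window_def window_iff using cell by (simp add: cell_def)
    moreover have "\<bar>(x - y) $ l\<bar> \<le> 1 / real m" for l
    proof -
      have "\<lfloor>real m * x $ l\<rfloor> = \<lfloor>real m * y $ l\<rfloor>"
        using cell[of l] by (simp add: cell_def)
      then have "\<bar>real m * x $ l - real m * y $ l\<bar> \<le> 1"
        by linarith
      moreover have "real m * x $ l - real m * y $ l = real m * (x $ l - y $ l)"
        by (simp add: algebra_simps)
      ultimately have "real m * \<bar>x $ l - y $ l\<bar> \<le> 1"
        by (simp add: abs_mult)
      then show ?thesis
        using \<open>m > 0\<close> by (simp add: field_simps)
    qed
    ultimately show ?thesis
      using \<open>y \<in> R\<close> by (auto simp: rnorm_le_iff)
  qed
  ultimately show ?thesis by blast
qed

section \<open>Weighted means and kernel weights\<close>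

definition weighted_mean :: "'i set \<Rightarrow> ('i \<Rightarrow> real) \<Rightarrow> ('i \<Rightarrow> real) \<Rightarrow> real" where
  "weighted_mean W w e = (\<Sum>i\<in>W. w i * e i) / (\<Sum>i\<in>W. w i)"

text \<open>Numerator and normalisation change by at most \<open>s * B\<close> and \<open>s\<close>
  per site, while the normalisation is at least \<open>c\<close> per site. Each effect contributes
  \<open>B * s / c\<close>, and the size of \<open>W\<close> cancels.\<close>

lemma weighted_mean_diff_le:
  assumes "finite W" "W \<noteq> {}" "c > 0"
    and w: "\<And>i. i \<in> W \<Longrightarrow> w i \<ge> c" and w': "\<And>i. i \<in> W \<Longrightarrow> w' i \<ge> c"
    and s: "\<And>i. i \<in> W \<Longrightarrow> \<bar>w i - w' i\<bar> \<le> s"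
    and e: "\<And>i. i \<in> W \<Longrightarrow> \<bar>e i\<bar> \<le> B"
  shows "\<bar>weighted_mean W w e - weighted_mean W w' e\<bar> \<le> 2 * B * s / c"
proof -
  define N where "N = real (card W)"
  have "N > 0"
    using assms by (simp add: N_def card_gt_0_iff)
  obtain i where "i \<in> W"
    using assms by blast
  have "B \<ge> 0" "s \<ge> 0"
    using e[OF \<open>i \<in> W\<close>] s[OF \<open>i \<in> W\<close>] by linarith+
  define X X' Z Z' where "X = (\<Sum>i\<in>W. w i * e i)" "X' = (\<Sum>i\<in>W. w' i * e i)"
    and "Z = (\<Sum>i\<in>W. w i)" "Z' = (\<Sum>i\<in>W. w' i)"
  note defs = this
  have Z: "c * N \<le> Z" "c * N \<le> Z'"
    unfolding defs N_def using sum_bounded_below[of W c w] sum_bounded_below[of W c w'] w w'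
    by (simp_all add: mult.commute)
  have pos: "c * N > 0"
    using \<open>c > 0\<close> \<open>N > 0\<close> by simp
  have X: "\<bar>X - X'\<bar> \<le> N * (s * B)"
  proof -
    have "\<bar>X - X'\<bar> = \<bar>\<Sum>i\<in>W. (w i - w' i) * e i\<bar>"
      by (simp add: defs sum_subtractf algebra_simps)
    also have "\<dots> \<le> (\<Sum>i\<in>W. s * B)"
      using s e \<open>s \<ge> 0\<close> by (intro sum_abs[THEN order_trans] sum_mono) (auto simp: abs_mult intro!: mult_mono)
    finally show ?thesis
      by (simp add: N_def)
  qed
  have ZZ: "\<bar>Z' - Z\<bar> \<le> N * s"
  proof -
    have "\<bar>Z' - Z\<bar> = \<bar>\<Sum>i\<in>W. w' i - w i\<bar>"
      by (simp add: defs sum_subtractf)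
    also have "\<dots> \<le> (\<Sum>i\<in>W. s)"
      using s by (intro sum_abs[THEN order_trans] sum_mono) (simp add: abs_minus_commute)
    finally show ?thesis
      by (simp add: N_def)
  qed
  have X': "\<bar>X' / Z'\<bar> \<le> B"
  proof -
    have "\<bar>X'\<bar> \<le> (\<Sum>i\<in>W. w' i * B)"
      unfolding defs using w' e \<open>c > 0\<close>
      by (intro sum_abs[THEN order_trans] sum_mono) (force simp: abs_mult intro!: mult_mono)
    also have "\<dots> = B * Z'"
      by (simp add: defs sum_distrib_left mult.commute)
    finally show ?thesis
      using Z pos by (simp add: field_simps)
  qed
  have "X / Z - X' / Z' = (X - X') / Z + X' / Z' * ((Z' - Z) / Z)"
    using Z pos by (simp add: field_simps)
  then have "\<bar>X / Z - X' / Z'\<bar> \<le> \<bar>(X - X') / Z\<bar> + \<bar>X' / Z'\<bar> * \<bar>(Z' - Z) / Z\<bar>"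
    by (metis abs_mult abs_triangle_ineq)
  also have "\<dots> \<le> N * (s * B) / (c * N) + B * (N * s / (c * N))"
  proof (intro add_mono mult_mono)
    have "c * N \<le> \<bar>Z\<bar>"
      using Z by linarith
    then show "\<bar>(X - X') / Z\<bar> \<le> N * (s * B) / (c * N)" "\<bar>(Z' - Z) / Z\<bar> \<le> N * s / (c * N)"
      unfolding abs_divide using X ZZ pos by (intro frac_le; linarith)+
  qed (use X' \<open>B \<ge> 0\<close> in auto)
  also have "\<dots> = 2 * B * s / c"
    using \<open>N > 0\<close> \<open>c > 0\<close> by (simp add: field_simps)
  finally show ?thesis
    by (simp add: weighted_mean_def defs)
qed

definition kernel_weight :: "((real, 'd::finite) vec \<Rightarrow> real) \<Rightarrow> real \<Rightarrow> nat \<Rightarrow> (real, 'd) vec \<Rightarrow> (int, 'd) vec \<Rightarrow> real" where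
  "kernel_weight K r n x i = K ((1 / r) *\<^sub>R (x - (1 / real n) *\<^sub>R vec_of_int i))"

lemma rnorm_scaled_le_1_iff:
  assumes "r > 0"
  shows "rnorm ((1 / r) *\<^sub>R (x - (1 / real n) *\<^sub>R vec_of_int i)) \<le> 1 \<longleftrightarrow>
    (\<forall>l. \<bar>x $ l - real_of_int (i $ l) / real n\<bar> \<le> r)"
  using assms by (auto simp: rnorm_le_iff vec_of_int_def abs_mult divide_le_eq)

lemma kernel_weight_outside_window:
  assumes "\<And>x. rnorm x > 1 \<Longrightarrow> K x = 0" "r > 0" "i \<in> Lambda n" "i \<notin> window n r x"
  shows "kernel_weight K r n x i = 0"
proof -
  have "\<not> rnorm ((1 / r) *\<^sub>R (x - (1 / real n) *\<^sub>R vec_of_int i)) \<le> 1"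
    using assms(3,4) unfolding rnorm_scaled_le_1_iff[OF \<open>r > 0\<close>] by (simp add: window_def)
  then show ?thesis
    unfolding kernel_weight_def by (intro assms(1)) simp
qed

lemma kernel_weight_in_window:
  assumes "\<forall>x. rnorm x \<le> 1 \<longrightarrow> c \<le> K x \<and> K x \<le> C" "r > 0" "i \<in> window n r x"
  shows "c \<le> kernel_weight K r n x i \<and> kernel_weight K r n x i \<le> C"
  using assms rnorm_scaled_le_1_iff[OF \<open>r > 0\<close>, of x n i]
  by (auto simp: kernel_weight_def window_def)

text \<open>The Lipschitz condition holds only inside the support cube, so \<open>i\<close> must be
  seen from both points; rescaling by the bandwidth turns distance \<open>s\<close> into
  \<open>s / r\<close>.\<close>

lemma kernel_weight_lipschitz:
  assumes "\<forall>x y. rnorm x \<le> 1 \<longrightarrow> rnorm y \<le> 1 \<longrightarrow> \<bar>K x - K y\<bar> \<le> \<eta> * rnorm (x - y)" "\<eta> > 0"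
    and "r > 0" "i \<in> window n r x" "i \<in> window n r y" "rnorm (x - y) \<le> s"
  shows "\<bar>kernel_weight K r n x i - kernel_weight K r n y i\<bar> \<le> \<eta> * (s / r)"
proof -
  let ?f = "\<lambda>x. (1 / r) *\<^sub>R (x - (1 / real n) *\<^sub>R vec_of_int i)"
  have "rnorm (?f x) \<le> 1" "rnorm (?f y) \<le> 1"
    using assms(4,5) unfolding rnorm_scaled_le_1_iff[OF \<open>r > 0\<close>] by (simp_all add: window_def)
  then have "\<bar>K (?f x) - K (?f y)\<bar> \<le> \<eta> * rnorm (?f x - ?f y)"
    using assms(1) by blast
  also have "rnorm (?f x - ?f y) \<le> s / r"
    using assms(3,6) by (auto simp: rnorm_le_iff abs_mult divide_right_mono simp flip: diff_divide_distrib)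
  finally show ?thesis
    using \<open>\<eta> > 0\<close> by (simp add: kernel_weight_def)
qed

text \<open>The weights are deterministic, so the regression part cancels against the mean and only
  noise remains; sites outside the window carry weight 0.\<close>

lemma (in stationary_bounded_field) gn_centered:
  assumes mean0: "(\<integral>\<omega>. eps 0 \<omega> \<partial>M) = 0"
    and supp: "\<And>x. rnorm x > 1 \<Longrightarrow> K x = 0" and "h n > 0"
  shows "gn g eps K h n x \<omega> - (\<integral>\<omega>. gn g eps K h n x \<omega> \<partial>M) =
    weighted_mean (window n (h n) x) (kernel_weight K (h n) n x) (\<lambda>i. eps i \<omega>)"
proof -
  define w where "w = kernel_weight K (h n) n x"
  define Z where "Z = (\<Sum>i\<in>Lambda n. w i)"
  define G where "G = (\<Sum>i\<in>Lambda n. g ((1 / real n) *\<^sub>R vec_of_int i) * w i)"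
  have gn: "gn g eps K h n x \<omega> = (G + (\<Sum>i\<in>Lambda n. w i * eps i \<omega>)) / Z" for \<omega>
    unfolding gn_def Z_def G_def w_def kernel_weight_def
    by (simp add: distrib_right sum.distrib mult.commute)
  have int: "integrable M (\<lambda>\<omega>. \<Sum>i\<in>Lambda n. w i * eps i \<omega>)"
    by (rule ae_bounded_integrable[OF ae_bounded_lincomb])
  have "(\<integral>\<omega>. (\<Sum>i\<in>Lambda n. w i * eps i \<omega>) \<partial>M) = (\<Sum>i\<in>Lambda n. w i * (\<integral>\<omega>. eps i \<omega> \<partial>M))"
    using ae_bounded_integrable[OF ae_bounded_eps] by (subst Bochner_Integration.integral_sum) auto
  also have "\<dots> = 0"
    using mean0 integral_eps by simp
  finally have "(\<integral>\<omega>. gn g eps K h n x \<omega> \<partial>M) = G / Z"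
    unfolding gn using int by (simp add: Bochner_Integration.integral_add prob_space)
  then have "gn g eps K h n x \<omega> - (\<integral>\<omega>. gn g eps K h n x \<omega> \<partial>M) = (\<Sum>i\<in>Lambda n. w i * eps i \<omega>) / Z"
    unfolding gn by (simp add: add_divide_distrib)
  moreover have "window n (h n) x \<subseteq> Lambda n"
    by (auto simp: window_def)
  moreover have "w i = 0" if "i \<in> Lambda n - window n (h n) x" for i
    unfolding w_def using that assms by (intro kernel_weight_outside_window[OF supp]) auto
  ultimately show ?thesis
    unfolding weighted_mean_def w_def[symmetric] Z_def
    using sum.mono_neutral_left[OF finite_Lambda, of "window n (h n) x" n w]
      sum.mono_neutral_left[OF finite_Lambda, of "window n (h n) x" n "\<lambda>i. w i * eps i \<omega>"]
    by auto
qed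

section \<open>Uniform deviation\<close>

text \<open>With \<open>N\<close> sites in the window the weights sum to at least
  \<open>c * N\<close>, so a mean of size \<open>t\<close> forces a sum of size
  \<open>t * c * N\<close>. One factor \<open>N\<close> cancels in the Gaussian exponent, and
  \<open>card_window\<close> bounds the other from below uniformly in \<open>y\<close>.\<close>

lemma (in stationary_bounded_field) net_deviation_prob:
  fixes R :: "(real, 'd) vec set"
  assumes fin: "\<And>k. k \<in> Vset 1 \<Longrightarrow> linf M (\<lambda>\<omega>. eps k \<omega> *
      real_cond_exp M (field_sigma M eps (Vset (inorm k))) (eps 0) \<omega>) < \<infinity>"
    and D: "\<And>U. finite U \<Longrightarrow> U \<subseteq> Vset 1 \<Longrightarrow> (\<Sum>k\<in>U. delta k) \<le> D"
    and L: "B\<^sup>2 + 2 * D \<le> L" "L > 0"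
    and K: "\<forall>x. rnorm x \<le> 1 \<longrightarrow> c \<le> K x \<and> K x \<le> C" "c > 0" "C > 0"
    and r: "0 < r" "r \<le> 1 / 2" "real n * r \<ge> 2"
    and R: "R \<subseteq> unit_cube" "finite R" and "t \<ge> 0"
  shows "{\<omega> \<in> space M. \<exists>y\<in>R. t \<le> \<bar>weighted_mean (window n r y) (kernel_weight K r n y) (\<lambda>i. eps i \<omega>)\<bar>} \<in> events"
    and "prob {\<omega> \<in> space M. \<exists>y\<in>R. t \<le> \<bar>weighted_mean (window n r y) (kernel_weight K r n y) (\<lambda>i. eps i \<omega>)\<bar>}
      \<le> real (card R) * (2 * exp (- (t * c)\<^sup>2 * (real n * r / 2) ^ CARD('d) / (4 * C\<^sup>2 * L)))"
proof -
  define E where "E y = {\<omega> \<in> space M. t \<le> \<bar>weighted_mean (window n r y) (kernel_weight K r n y) (\<lambda>i. eps i \<omega>)\<bar>}" for y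
  define p where "p = 2 * exp (- (t * c)\<^sup>2 * (real n * r / 2) ^ CARD('d) / (4 * C\<^sup>2 * L))"
  have E_meas: "E y \<in> events" for y
    unfolding E_def weighted_mean_def by measurable
  have eq: "{\<omega> \<in> space M. \<exists>y\<in>R. t \<le> \<bar>weighted_mean (window n r y) (kernel_weight K r n y) (\<lambda>i. eps i \<omega>)\<bar>} = (\<Union>y\<in>R. E y)"
    by (auto simp: E_def)
  have "(\<Union>y\<in>R. E y) \<in> events"
    using E_meas R(2) by (intro sets.finite_UN) auto
  with eq show "{\<omega> \<in> space M. \<exists>y\<in>R. t \<le> \<bar>weighted_mean (window n r y) (kernel_weight K r n y) (\<lambda>i. eps i \<omega>)\<bar>} \<in> events"
    by simp
  have pE: "prob (E y) \<le> p" if "y \<in> R" for y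
  proof -
    define W where "W = window n r y"
    define w where "w = kernel_weight K r n y"
    define N where "N = real (card W)"
    have N: "(real n * r / 2) ^ CARD('d) \<le> N"
      unfolding N_def W_def using that R r by (intro card_window) auto
    moreover have "0 < (real n * r / 2) ^ CARD('d)"
      using r by simp
    ultimately have "N > 0"
      by linarith
    then have W: "finite W" "W \<noteq> {}"
      by (auto simp: N_def card_gt_0_iff)
    have w: "c \<le> w i" "w i \<le> C" if "i \<in> W" for i
      using kernel_weight_in_window[OF K(1) r(1), of i n y] that by (auto simp: w_def W_def)
    have sum_w: "c * N \<le> (\<Sum>i\<in>W. w i)"
      using sum_bounded_below[of W c w] w by (simp add: N_def mult.commute)
    have sum_pos: "0 < (\<Sum>i\<in>W. w i)"
      using sum_w mult_pos_pos[OF K(2) \<open>N > 0\<close>] by linarith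
    have "prob (E y) \<le> prob {\<omega> \<in> space M. \<bar>\<Sum>i\<in>W. w i * eps i \<omega>\<bar> \<ge> t * (c * N)}"
    proof (rule finite_measure_mono)
      show "E y \<subseteq> {\<omega> \<in> space M. \<bar>\<Sum>i\<in>W. w i * eps i \<omega>\<bar> \<ge> t * (c * N)}"
      proof
        fix \<omega> assume "\<omega> \<in> E y"
        then have \<omega>: "\<omega> \<in> space M" "t \<le> \<bar>\<Sum>i\<in>W. w i * eps i \<omega>\<bar> / (\<Sum>i\<in>W. w i)"
          using sum_pos by (auto simp: E_def weighted_mean_def abs_divide simp flip: W_def w_def)
        have "t * (c * N) \<le> t * (\<Sum>i\<in>W. w i)"
          using sum_w \<open>t \<ge> 0\<close> by (rule mult_left_mono)
        also have "\<dots> \<le> \<bar>\<Sum>i\<in>W. w i * eps i \<omega>\<bar>"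
          using \<omega>(2) sum_pos by (simp add: pos_le_divide_eq)
        finally show "\<omega> \<in> {\<omega> \<in> space M. \<bar>\<Sum>i\<in>W. w i * eps i \<omega>\<bar> \<ge> t * (c * N)}"
          using \<omega> by simp
      qed
    qed measurable
    also have "\<dots> \<le> 2 * exp (- (t * (c * N))\<^sup>2 / (4 * C\<^sup>2 * L * real (card W)))"
      using w K \<open>N > 0\<close> \<open>t \<ge> 0\<close> by (intro tail_bound[OF fin D W _ L]) (auto simp: abs_le_iff, smt (verit))
    also have "- (t * (c * N))\<^sup>2 / (4 * C\<^sup>2 * L * real (card W)) = - ((t * c)\<^sup>2 * N / (4 * C\<^sup>2 * L))"
      using \<open>N > 0\<close> by (simp add: N_def[symmetric] power2_eq_square)
    also have "2 * exp \<dots> \<le> 2 * exp (- ((t * c)\<^sup>2 * (real n * r / 2) ^ CARD('d) / (4 * C\<^sup>2 * L)))"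
      using N L by (auto intro!: divide_right_mono mult_left_mono)
    finally show ?thesis
      by (simp add: p_def)
  qed
  have "prob (\<Union>y\<in>R. E y) \<le> (\<Sum>y\<in>R. prob (E y))"
    using R E_meas by (intro finite_measure_subadditive_finite) auto
  also have "\<dots> \<le> real (card R) * p"
    using pE by (rule sum_bounded_above)
  finally show "prob {\<omega> \<in> space M. \<exists>y\<in>R. t \<le> \<bar>weighted_mean (window n r y) (kernel_weight K r n y) (\<lambda>i. eps i \<omega>)\<bar>}
      \<le> real (card R) * (2 * exp (- (t * c)\<^sup>2 * (real n * r / 2) ^ CARD('d) / (4 * C\<^sup>2 * L)))"
    by (simp add: eq p_def)
qed

lemma powr_half_eq_sqrt_power: "x > 0 \<Longrightarrow> x powr (real d / 2) = sqrt (x ^ d)"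
  by (simp add: powr_half_sqrt[symmetric] powr_powr powr_realpow[symmetric])

section \<open>The uniform almost sure rate\<close>

theorem theorem1:
  fixes M :: "'a measure"
    and eps :: "(int, 'd::{finite,linorder}) vec \<Rightarrow> 'a \<Rightarrow> real"
    and g :: "(real, 'd) vec \<Rightarrow> real"
    and K :: "(real, 'd) vec \<Rightarrow> real"
    and h :: "nat \<Rightarrow> real"
  assumes prob: "prob_space M"
    and meas: "\<And>i. eps i \<in> borel_measurable M"
    and stat: "strictly_stationary M eps"
    and mean0: "integral\<^sup>L M (eps 0) = 0"
    and h_pos: "\<And>n. h n > 0"
    and h_lim: "h \<longlonglongrightarrow> 0"
    and nh_lim: "filterlim (\<lambda>n. real n * h n) at_top sequentially"
    \<comment> \<open>K is a probability density on R^d\<close>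
    and K_meas: "K \<in> borel_measurable lborel"
    and K_dens: "(\<integral>\<^sup>+ x. ennreal (K x) \<partial>lborel) = 1"
    \<comment> \<open>(A1)\<close>
    and K_sym: "\<And>x. K (- x) = K x"
    and K_nonneg: "\<And>x. K x \<ge> 0"
    and K_supp: "\<And>x. rnorm x > 1 \<Longrightarrow> K x = 0"
    and K_lip: "\<exists>\<eta>>0. \<forall>x y. rnorm x \<le> 1 \<longrightarrow> rnorm y \<le> 1 \<longrightarrow>
                   \<bar>K x - K y\<bar> \<le> \<eta> * rnorm (x - y)"
    and K_bounds: "\<exists>c>0. \<exists>C>0. \<forall>x. rnorm x \<le> 1 \<longrightarrow> c \<le> K x \<and> K x \<le> C"
    \<comment> \<open>(C1)\<close>
    and C1_bdd: "\<exists>B. AE \<omega> in M. \<bar>eps 0 \<omega>\<bar> \<le> B"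
    and C1_fin: "\<forall>k\<in>Vset 1. linf M (\<lambda>\<omega>. eps k \<omega> *
                   real_cond_exp M (field_sigma M eps (Vset (inorm k))) (eps 0) \<omega>) < \<infinity>"
    and C1_sum: "(\<lambda>k. real_of_ereal (linf M (\<lambda>\<omega>. eps k \<omega> *
                   real_cond_exp M (field_sigma M eps (Vset (inorm k))) (eps 0) \<omega>)))
                 summable_on Vset 1"
  shows "\<exists>lam>0. AE \<omega> in M.
           limsup (\<lambda>n. (SUP x\<in>unit_cube. ereal \<bar>gn g eps K h n x \<omega> -
                                  integral\<^sup>L M (gn g eps K h n x)\<bar>)
                       / ereal (sqrt (ln (real n)) / (real n * h n) powr (real CARD('d) / 2)))
           \<le> ereal lam"
proof -
  interpret prob_space M by (rule prob)
  obtain B where B: "AE \<omega> in M. \<bar>eps 0 \<omega>\<bar> \<le> B"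
    using C1_bdd by blast
  interpret stationary_bounded_field M eps B
    by unfold_locales (use meas stat B in auto)
  obtain \<eta> where \<eta>: "\<eta> > 0" "\<forall>x y. rnorm x \<le> 1 \<longrightarrow> rnorm y \<le> 1 \<longrightarrow> \<bar>K x - K y\<bar> \<le> \<eta> * rnorm (x - y)"
    using K_lip by blast
  obtain c C where K: "\<forall>x. rnorm x \<le> 1 \<longrightarrow> c \<le> K x \<and> K x \<le> C" "c > 0" "C > 0"
    using K_bounds by blast
  note fin = C1_fin[rule_format]
  define D where "D = infsum delta (Vset 1)"
  have D: "(\<Sum>k\<in>U. delta k) \<le> D" if "finite U" "U \<subseteq> Vset 1" for U
    unfolding D_def using that C1_sum delta_nonneg[OF fin]
    by (intro finite_sum_le_infsum) (auto simp: delta_def[abs_def])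
  define L where "L = B\<^sup>2 + 2 * D + 1"
  have "D \<ge> 0"
    using D[of "{}"] by simp
  then have L: "B\<^sup>2 + 2 * D \<le> L" "L > 0"
    using zero_le_power2[of B] by (auto simp: L_def add_nonneg_pos)
  define d where "d = CARD('d)"
  \<comment> \<open>A constant times \<open>n ^ (d * (d + 3))\<close> bounds the size of the net;
    the additional 2 leaves the summable rate \<open>1 / n ^ 2\<close>.\<close>
  define P where "P = d * (d + 3) + 2"
  \<comment> \<open>Chosen so that at level \<open>\<mu> * v n\<close> the exponent is exactly
    \<open>P * ln n\<close>; the factor \<open>2 ^ d\<close> offsets the halves in the window
    count.\<close>
  define \<mu> where "\<mu> = sqrt (real P * (4 * C\<^sup>2 * L) * 2 ^ d / c\<^sup>2)"
  have \<mu>: "\<mu> > 0" "\<mu>\<^sup>2 * c\<^sup>2 = real P * (4 * C\<^sup>2 * L) * 2 ^ d"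
  proof -
    have "0 < real P"
      unfolding P_def of_nat_0_less_iff by simp
    then have "0 < real P * (4 * C\<^sup>2 * L) * 2 ^ d / c\<^sup>2"
      using K L by (intro divide_pos_pos mult_pos_pos) auto
    then show "\<mu> > 0" "\<mu>\<^sup>2 * c\<^sup>2 = real P * (4 * C\<^sup>2 * L) * 2 ^ d"
      using K by (simp_all add: \<mu>_def)
  qed
  define v where "v n = sqrt (ln (real n)) / (real n * h n) powr (real d / 2)" for n
  define Y where "Y n x \<omega> = weighted_mean (window n (h n) x) (kernel_weight K (h n) n x) (\<lambda>i. eps i \<omega>)" for n x \<omega>
  \<comment> \<open>The bounds on \<open>h n\<close> and \<open>n * h n\<close> make the window
    count available; \<open>ln n \<ge> 1\<close> keeps \<open>v n\<close> positive and at least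
    \<open>1 / n ^ d\<close>.\<close>
  define good where "good n \<longleftrightarrow> n > 0 \<and> ln (real n) \<ge> 1 \<and> h n \<le> 1 / 2 \<and> real n * h n \<ge> 2" for n
  have good: "eventually good sequentially"
  proof -
    have "eventually (\<lambda>n. h n < 1 / 2) sequentially"
      by (rule order_tendstoD(2)[OF h_lim]) simp
    moreover have "eventually (\<lambda>n. real n * h n \<ge> 2) sequentially"
      using nh_lim by (auto simp: filterlim_at_top)
    moreover have "eventually (\<lambda>n. ln (real n) \<ge> 1) sequentially"
      using filterlim_compose[OF ln_at_top filterlim_real_sequentially] by (auto simp: filterlim_at_top)
    moreover have "eventually (\<lambda>n. n > 0) sequentially"
      by (rule eventually_gt_at_top)
    ultimately show ?thesis
      by eventually_elim (auto simp: good_def)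
  qed
  have v_sq: "(v n)\<^sup>2 = ln (real n) / (real n * h n) ^ d" and v_pos: "v n > 0"
    and v_ge: "1 / real n ^ d \<le> v n" if "good n" for n
  proof -
    have n: "n > 0" "ln (real n) \<ge> 1" "h n \<le> 1 / 2" "real n * h n \<ge> 2"
      using that by (auto simp: good_def)
    have v: "v n = sqrt (ln (real n) / (real n * h n) ^ d)"
      using n by (simp add: v_def powr_half_eq_sqrt_power real_sqrt_divide)
    have nh: "0 < (real n * h n) ^ d"
      using n by (intro zero_less_power) linarith
    then have "0 < ln (real n) / (real n * h n) ^ d"
      using n by (intro divide_pos_pos; linarith)
    then show "(v n)\<^sup>2 = ln (real n) / (real n * h n) ^ d" "v n > 0"
      by (simp_all add: v)
    have "real n * h n \<le> real n * 1"
      using n by (intro mult_left_mono) auto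
    then have "(real n * h n) ^ d \<le> real n ^ d"
      using n by (intro power_mono) auto
    then have "1 / real n ^ d \<le> ln (real n) / (real n * h n) ^ d"
      using n nh by (intro frac_le; linarith)
    moreover have "(1 / real n ^ d)\<^sup>2 \<le> 1 / real n ^ d"
      using n by (simp add: power2_eq_square field_simps)
    ultimately show "1 / real n ^ d \<le> v n"
      unfolding v by (intro real_le_rsqrt) linarith
  qed
  \<comment> \<open>With mesh \<open>1 / n ^ (d + 1)\<close> the rescaled distance to the net is at
    most \<open>1 / n ^ d\<close> divided by \<open>n * h n\<close>, hence at most
    \<open>v n\<close>.\<close>
  define net where "net n R \<longleftrightarrow> R \<subseteq> (unit_cube :: (real, 'd) vec set) \<and> finite R \<and>
      card R \<le> ((n ^ (d + 1) + 1) * (2 * n + 1)\<^sup>2) ^ d \<and>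
      (\<forall>x\<in>unit_cube. \<exists>y\<in>R. window n (h n) x = window n (h n) y \<and> rnorm (x - y) \<le> 1 / real (n ^ (d + 1)))" for n R
  have "\<exists>R. net n R" if "good n" for n
    using finite_net_windows[of n "n ^ (d + 1)" "h n", where 'd = 'd] that h_pos[of n]
    unfolding net_def d_def good_def by (auto simp del: of_nat_power)
  then obtain R where R: "\<And>n. good n \<Longrightarrow> net n (R n)"
    by metis
  define A where "A n = (if good n then {\<omega> \<in> space M. \<exists>y\<in>R n. \<mu> * v n \<le> \<bar>Y n y \<omega>\<bar>} else {})" for n
  have A: "A n \<in> events" "prob (A n) \<le> 2 * 18 ^ d * inverse (real n ^ 2)" for n
  proof -
    have "A n \<in> events \<and> prob (A n) \<le> 2 * 18 ^ d * inverse (real n ^ 2)"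
    proof (cases "good n")
      case True
      then have n: "n > 0" "ln (real n) \<ge> 1" "h n \<le> 1 / 2" "real n * h n \<ge> 2"
        by (auto simp: good_def)
      have Rn: "R n \<subseteq> unit_cube" "finite (R n)" "card (R n) \<le> ((n ^ (d + 1) + 1) * (2 * n + 1)\<^sup>2) ^ d"
        using R[OF True] by (auto simp: net_def)
      have A_eq: "A n = {\<omega> \<in> space M. \<exists>y\<in>R n. \<mu> * v n \<le> \<bar>Y n y \<omega>\<bar>}"
        using True by (simp add: A_def)
      have t: "\<mu> * v n \<ge> 0"
        using \<mu> v_pos[OF True] by simp
      note dev = net_deviation_prob[OF fin D L K h_pos n(3,4) Rn(1,2) t, folded Y_def d_def]
      have "(\<mu> * v n * c)\<^sup>2 * (real n * h n / 2) ^ d / (4 * C\<^sup>2 * L) =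
          (\<mu>\<^sup>2 * c\<^sup>2) * (v n)\<^sup>2 * ((real n * h n) ^ d / 2 ^ d) / (4 * C\<^sup>2 * L)"
        by (simp add: power_mult_distrib power_divide)
      also have "\<dots> = real P * ln (real n)"
        unfolding \<mu>(2) v_sq[OF True] using n K L h_pos[of n] by simp
      finally have expo: "- (\<mu> * v n * c)\<^sup>2 * (real n * h n / 2) ^ d / (4 * C\<^sup>2 * L) = - (real P * ln (real n))"
        by simp
      have "exp (real P * ln (real n)) = real n ^ P"
        using n by (simp add: exp_of_nat_mult)
      then have exp_eq: "exp (- (real P * ln (real n))) = inverse (real n ^ P)"
        by (simp add: exp_minus)
      have "card (R n) \<le> (18 * n ^ (d + 3)) ^ d"
      proof (rule order_trans[OF Rn(3) power_mono])
        \<comment> \<open>For \<open>n \<ge> 1\<close> the factors are at most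
          \<open>2 * n ^ (d + 1)\<close> and \<open>(3 * n)\<^sup>2\<close>, whence 18.\<close>
        have "(n ^ (d + 1) + 1) * (2 * n + 1)\<^sup>2 \<le> (2 * n ^ (d + 1)) * (3 * n)\<^sup>2"
          using n by (intro mult_mono power_mono) auto
        also have "\<dots> = 18 * n ^ (d + 3)"
          by (simp add: power_add power2_eq_square power3_eq_cube)
        finally show "(n ^ (d + 1) + 1) * (2 * n + 1)\<^sup>2 \<le> 18 * n ^ (d + 3)" .
      qed simp
      then have "real (card (R n)) \<le> real ((18 * n ^ (d + 3)) ^ d)"
        by (simp only: of_nat_le_iff)
      also have "\<dots> = 18 ^ d * real n ^ (d * (d + 3))"
        by (simp add: power_mult_distrib mult.commute flip: power_mult)
      finally have card: "real (card (R n)) \<le> 18 ^ d * real n ^ (d * (d + 3))" .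
      have "prob (A n) \<le> real (card (R n)) * (2 * inverse (real n ^ P))"
        using dev(2) unfolding expo exp_eq A_eq by blast
      also have "\<dots> \<le> 18 ^ d * real n ^ (d * (d + 3)) * (2 * inverse (real n ^ P))"
        using card by (rule mult_right_mono) simp
      also have "\<dots> = 2 * 18 ^ d * inverse (real n ^ 2)"
        using n by (simp add: P_def power_add power2_eq_square field_simps)
      finally show ?thesis
        using dev(1) unfolding A_eq by blast
    qed (simp add: A_def)
    then show "A n \<in> events" "prob (A n) \<le> 2 * 18 ^ d * inverse (real n ^ 2)"
      by auto
  qed
  have "summable (\<lambda>n. prob (A n))"
  proof (rule summable_comparison_test)
    show "summable (\<lambda>n. 2 * 18 ^ d * inverse (real n ^ 2))"
      by (intro summable_mult inverse_power_summable) auto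
  qed (use A in auto)
  then have "AE \<omega> in M. eventually (\<lambda>n. \<omega> \<in> space M - A n) sequentially"
    using A by (intro borel_cantelli_AE1) (auto simp: emeasure_eq_measure)
  \<comment> \<open>The lattice is countable, so a single null set serves all sites.\<close>
  moreover have "AE \<omega> in M. \<forall>i. \<bar>eps i \<omega>\<bar> \<le> B"
    using eps_bounded by (simp add: AE_all_countable)
  ultimately have "AE \<omega> in M. limsup (\<lambda>n. (SUP x\<in>unit_cube. ereal \<bar>gn g eps K h n x \<omega> -
      integral\<^sup>L M (gn g eps K h n x)\<bar>) / ereal (v n)) \<le> ereal (\<mu> + 2 * B * \<eta> / c)"
  proof eventually_elim
    case (elim \<omega>)
    have "eventually (\<lambda>n. (SUP x\<in>unit_cube. ereal \<bar>gn g eps K h n x \<omega> -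
      integral\<^sup>L M (gn g eps K h n x)\<bar>) / ereal (v n) \<le> ereal (\<mu> + 2 * B * \<eta> / c)) sequentially"
      using elim(1) good
    proof eventually_elim
      case (elim n)
      note good_n = elim(2)
      have n: "n > 0" "ln (real n) \<ge> 1" "h n \<le> 1 / 2" "real n * h n \<ge> 2"
        using good_n by (auto simp: good_def)
      have vn: "v n > 0"
        by (rule v_pos[OF good_n])
      \<comment> \<open>From here \<open>\<omega>\<close> is fixed and the estimate is pathwise, so
        the supremum over uncountably many \<open>x\<close> raises no measurability
        question.\<close>
      have bound: "\<bar>gn g eps K h n x \<omega> - integral\<^sup>L M (gn g eps K h n x)\<bar> \<le> (\<mu> + 2 * B * \<eta> / c) * v n"
        if x: "x \<in> unit_cube" for x
      proof -
        obtain y where y: "y \<in> R n" "window n (h n) x = window n (h n) y"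
            "rnorm (x - y) \<le> 1 / real (n ^ (d + 1))"
          using R[OF good_n] x unfolding net_def by blast
        define W where "W = window n (h n) x"
        have "0 < (real n * h n / 2) ^ CARD('d)"
          using n by simp
        also have "\<dots> \<le> real (card W)"
          unfolding W_def by (rule card_window[OF x n(3,4)])
        finally have W: "finite W" "W \<noteq> {}"
          by (auto simp: card_gt_0_iff)
        have "\<bar>Y n y \<omega>\<bar> < \<mu> * v n"
          using elim good_n y(1) by (auto simp: A_def not_le)
        moreover have "\<bar>Y n x \<omega> - Y n y \<omega>\<bar> \<le> 2 * B * (\<eta> * (1 / real (n ^ (d + 1)) / h n)) / c"
          unfolding Y_def y(2)[symmetric] W_def[symmetric]
        proof (rule weighted_mean_diff_le[OF W K(2)])
          fix i assume "i \<in> W"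
          then have i: "i \<in> window n (h n) x" "i \<in> window n (h n) y"
            using y(2) by (auto simp: W_def)
          show "c \<le> kernel_weight K (h n) n x i" "c \<le> kernel_weight K (h n) n y i"
            using kernel_weight_in_window[OF K(1) h_pos] i by blast+
          show "\<bar>kernel_weight K (h n) n x i - kernel_weight K (h n) n y i\<bar> \<le> \<eta> * (1 / real (n ^ (d + 1)) / h n)"
            by (rule kernel_weight_lipschitz[OF \<eta>(2,1) h_pos i y(3)])
          show "\<bar>eps i \<omega>\<bar> \<le> B"
            using \<open>\<forall>i. \<bar>eps i \<omega>\<bar> \<le> B\<close> by blast
        qed
        moreover have "2 * B * (\<eta> * (1 / real (n ^ (d + 1)) / h n)) / c \<le> 2 * B * \<eta> / c * v n"
        proof -
          have "1 / real (n ^ (d + 1)) / h n = 1 / real n ^ d * (1 / (real n * h n))"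
            by simp
          also have "\<dots> \<le> 1 / real n ^ d * 1"
            using n by (intro mult_left_mono) auto
          also have "\<dots> \<le> v n"
            using v_ge[OF good_n] by simp
          finally have "2 * B * \<eta> / c * (1 / real (n ^ (d + 1)) / h n) \<le> 2 * B * \<eta> / c * v n"
            using B_nonneg \<eta> K by (intro mult_left_mono) auto
          then show ?thesis by (simp add: mult_ac)
        qed
        moreover have "gn g eps K h n x \<omega> - integral\<^sup>L M (gn g eps K h n x) = Y n x \<omega>"
          unfolding Y_def by (rule gn_centered[OF mean0 K_supp h_pos])
        ultimately show ?thesis
          by (simp add: distrib_right)
      qed
      have "(SUP x\<in>unit_cube. ereal \<bar>gn g eps K h n x \<omega> - integral\<^sup>L M (gn g eps K h n x)\<bar>)
          \<le> ereal ((\<mu> + 2 * B * \<eta> / c) * v n)"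
        using bound by (intro SUP_least) simp
      then show ?case
        using vn by (subst ereal_divide_le_pos) (auto simp: mult.commute)
    qed
    then show ?case
      by (rule Limsup_bounded)
  qed
  moreover have "\<mu> + 2 * B * \<eta> / c > 0"
    using \<mu> B_nonneg \<eta> K by (intro add_pos_nonneg) auto
  ultimately show ?thesis
    unfolding v_def d_def by blast
qed

end
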